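(* Consider the network equation of the output node signal $w_j(t)$, $$w_j(t) = \sum_{k \in \mathcal{N}_j} G_{jk}(q)w_k(t) + r_j(t) + v_j(t),\qquad v_j(t)=H_j(q)e_j(t),$$ and let $i\in\mathcal N_j$. This network equation can be represented in an alternative way as $$w_j(t) = M_j(q)w_j(t) - (1-M_j(q))\bar F_{ji}(q)w_j(t) + (1-M_j(q))B_{ji}(q)w_i(t) + \sum_{k \in \mathcal{N}_j\setminus\{i\}} M_{jk}(q)w_k(t) + \bar e_j(t),$$ where $$M_j(q) = 1 - (H_j)^{-1}(q)\,\frac{\prod_{k\in \mathcal{N}_j \setminus \{i\}}F_{jk}^{(a)}(q)}{F_a^{\ast}(q)F_{ji}^{(s)}(q)},\qquad M_{jk}(q) = (H_j)^{-1}(q)\,\frac{\prod_{\ell\in \mathcal{N}_j \setminus \{k\}}F_{j\ell}^{(a)}(q)}{F_a^{\ast}(q)}\,\frac{B_{jk}(q)}{F_{jk}^{(s)}(q)}\quad (k\in\mathcal N_j\setminus\{i\})$$ are strictly proper predictor filters, $B_{ji}(q)$ and $\bar F_{ji}(q) = -(1-F_{ji}(q))$ are stable polynomials representing $G_{ji}(q)=B_{ji}(q)/F_{ji}(q)=B_{ji}(q)/(1+\bar F_{ji}(q))$, and $\bar e_j(t)$ is a Gaussian white noise with variance $\bar\sigma_j^2$, where $\bar\sigma_j^2=|f_{a,n}|^2\sigma_j^2$ and $f_{a,n}$ is the last coefficient of $F_a(q)$.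
   Context: The dynamic network has $L$ scalar measurable node signals $w_1,\dots,w_L$; $q^{-1}$ is the delay operator, $q^{-1}u(t)=u(t-1)$. The network is $w(t)=G(q)w(t)+r(t)+v(t)$, where $G(q)$ has zero diagonal, $(I-G(q))^{-1}$ is stable, and the network is well posed. $\mathcal N_j$ is the set of indices $k$ such that $G_{jk}\not\equiv 0$. Each $G_{jk}$ is a strictly proper rational transfer function, possibly unstable, $G_{jk}(q)=B_{jk}(q)/F_{jk}(q)$, with $B_{jk}(q)=b_{jk,1}q^{-1}+\dots+b_{jk,n_b}q^{-n_b}$ and $F_{jk}(q)=1+f_{jk,1}q^{-1}+\dots+f_{jk,n_f}q^{-n_f}$ (the degrees may depend on $j,k$). $H_j(q)$ is a monic, stable, minimum phase rational filter, and $e_j(t)$ is a Gaussian white noise of variance $\sigma_j^2$; $v_j$ is an unmeasured stationary process noise, uncorrelated with the process noises entering the other nodes. $r_j(t)$ is a measured external excitation signal entering node $j$ (it may be absent at some nodes). Each $F_{jk}$ is factorized as $F_{jk}=F_{jk}^{(s)}F_{jk}^{(a)}$, both factors monic polynomials in $q^{-1}$, where $F_{jk}^{(s)}$ contains the stable roots of $F_{jk}(z)$ (inside the unit circle) and $F_{jk}^{(a)}(q)=1+f^{(a)}_{jk,1}q^{-1}+\dots+f^{(a)}_{jk,n}q^{-n}$, with $f^{(a)}_{jk,n}\neq0$ (no loss of generality), contains the anti-stable roots. $F_{jk}^{\ast(a)}$ is the monic polynomial whose roots are the mirrored (stable) roots of $F_{jk}^{(a)}$, $F_{jk}^{\ast(a)}(q)=1+\frac{f^{(a)}_{jk,n-1}}{f^{(a)}_{jk,n}}q^{-1}+\dots+\frac{1}{f^{(a)}_{jk,n}}q^{-n}$.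 Further $F_a(q)=\prod_{k\in\mathcal N_j}F_{jk}^{(a)}(q)=1+f_{a,1}q^{-1}+\dots+f_{a,n}q^{-n}$ and $F_a^\ast(q)=\prod_{k\in\mathcal N_j}F_{jk}^{\ast(a)}(q)$ (here $n$ denotes the degree of the polynomial at hand; if $F_a=1$, then $f_{a,n}=1$).
   Formalization: The display omits r_j and is false if r_j≠0; it is proved as written for r_j=0, and in general with (1-M_j)(1+F̄_ji)r_j added. The network equation is read with denominators cleared, and the signals w_k, r_k are assumed to have bounded mean absolute value. *)

theory Defs
  imports "HOL-Probability.Probability"
    "HOL-Computational_Algebra.Computational_Algebra"
begin

(* Polynomials and formal power series are taken in the variable q^-1: the coefficient
   of index n multiplies q^-n.  A proper rational transfer function is identified with its
   impulse response, so that its value at z = infinity is the coefficient of index 0. *)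

(* The roots of a polynomial in q^-1 are counted in the z-plane (q = z), hence the inverse. *)
definition z_root :: "real poly \<Rightarrow> complex \<Rightarrow> bool" where
  "z_root p z \<longleftrightarrow> z \<noteq> 0 \<and> poly (map_poly complex_of_real p) (inverse z) = 0"

definition stable_roots :: "real poly \<Rightarrow> bool" where
  "stable_roots p \<longleftrightarrow> (\<forall>z. z_root p z \<longrightarrow> cmod z < 1)"

definition antistable_roots :: "real poly \<Rightarrow> bool" where
  "antistable_roots p \<longleftrightarrow> (\<forall>z. z_root p z \<longrightarrow> cmod z > 1)"

definition monic_in_delay :: "real poly \<Rightarrow> bool" where
  "monic_in_delay p \<longleftrightarrow> coeff p 0 = 1"

(* Proper rational transfer function with all its poles inside the unit circle. *)
definition stable_tf :: "real fps \<Rightarrow> bool" where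
  "stable_tf g \<longleftrightarrow> (\<exists>num den. coeff den 0 \<noteq> 0 \<and> stable_roots den \<and>
     g = fps_of_poly num / fps_of_poly den)"

(* Biproper rational transfer function with all its zeros inside the unit circle. *)
definition minimum_phase :: "real fps \<Rightarrow> bool" where
  "minimum_phase g \<longleftrightarrow> (\<exists>num den. coeff num 0 \<noteq> 0 \<and> coeff den 0 \<noteq> 0 \<and> stable_roots num \<and>
     g = fps_of_poly num / fps_of_poly den)"

definition monic_tf :: "real fps \<Rightarrow> bool" where
  "monic_tf g \<longleftrightarrow> fps_nth g 0 = 1"

definition strictly_proper :: "real fps \<Rightarrow> bool" where
  "strictly_proper g \<longleftrightarrow> fps_nth g 0 = 0"

(* For p = 1 + p_1 q^-1 + ... + p_n q^-n with p_n nonzero, this is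
   1 + (p_(n-1) / p_n) q^-1 + ... + (1 / p_n) q^-n. *)
definition mirror_poly :: "real poly \<Rightarrow> real poly" where
  "mirror_poly p = smult (inverse (lead_coeff p)) (reflect_poly p)"

(* A signal is a real process indexed by two-sided discrete time.  For a stable g and a
   signal whose mean absolute value is bounded, the series converges absolutely almost
   surely, for every t. *)
definition filt :: "real fps \<Rightarrow> (int \<Rightarrow> 'a \<Rightarrow> real) \<Rightarrow> int \<Rightarrow> 'a \<Rightarrow> real" where
  "filt g x t \<omega> = (\<Sum>n. fps_nth g n * x (t - int n) \<omega>)"

definition mean_bounded :: "'a measure \<Rightarrow> (int \<Rightarrow> 'a \<Rightarrow> real) \<Rightarrow> bool" where
  "mean_bounded M x \<longleftrightarrow> (\<forall>t. integrable M (x t)) \<and>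
     (\<exists>C. \<forall>t. (LINT \<omega>|M. \<bar>x t \<omega>\<bar>) \<le> C)"

definition second_order :: "'a measure \<Rightarrow> (int \<Rightarrow> 'a \<Rightarrow> real) \<Rightarrow> bool" where
  "second_order M x \<longleftrightarrow>
     (\<forall>t. x t \<in> borel_measurable M \<and> integrable M (\<lambda>\<omega>. (x t \<omega>)\<^sup>2))"

(* Stationarity in the wide sense. *)
definition stationary :: "'a measure \<Rightarrow> (int \<Rightarrow> 'a \<Rightarrow> real) \<Rightarrow> bool" where
  "stationary M x \<longleftrightarrow> second_order M x \<and>
     (\<forall>t s. (LINT \<omega>|M. x t \<omega>) = (LINT \<omega>|M. x s \<omega>)) \<and>
     (\<forall>t s d. (LINT \<omega>|M. x (t + d) \<omega> * x t \<omega>) = (LINT \<omega>|M. x (s + d) \<omega> * x s \<omega>))"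

definition uncorrelated :: "'a measure \<Rightarrow> (int \<Rightarrow> 'a \<Rightarrow> real) \<Rightarrow> (int \<Rightarrow> 'a \<Rightarrow> real) \<Rightarrow> bool" where
  "uncorrelated M x y \<longleftrightarrow>
     (\<forall>t s. (LINT \<omega>|M. x t \<omega> * y s \<omega>) = (LINT \<omega>|M. x t \<omega>) * (LINT \<omega>|M. y s \<omega>))"

(* Normally distributed; an almost surely constant variable is the degenerate case. *)
definition gaussian_rv :: "'a measure \<Rightarrow> ('a \<Rightarrow> real) \<Rightarrow> bool" where
  "gaussian_rv M X \<longleftrightarrow> X \<in> borel_measurable M \<and>
     ((\<exists>m s. s > 0 \<and> distributed M lborel X (normal_density m s)) \<or>
      (\<exists>m. AE \<omega> in M. X \<omega> = m))"

definition gaussian_process :: "'a measure \<Rightarrow> (int \<Rightarrow> 'a \<Rightarrow> real) \<Rightarrow> bool" where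
  "gaussian_process M x \<longleftrightarrow>
     (\<forall>T a. finite T \<longrightarrow> gaussian_rv M (\<lambda>\<omega>. \<Sum>t\<in>T. a t * x t \<omega>))"

definition white_noise :: "'a measure \<Rightarrow> (int \<Rightarrow> 'a \<Rightarrow> real) \<Rightarrow> real \<Rightarrow> bool" where
  "white_noise M x var \<longleftrightarrow> second_order M x \<and>
     (\<forall>t. (LINT \<omega>|M. x t \<omega>) = 0) \<and>
     (\<forall>t s. (LINT \<omega>|M. x t \<omega> * x s \<omega>) = (if t = s then var else 0))"

definition gaussian_white_noise :: "'a measure \<Rightarrow> (int \<Rightarrow> 'a \<Rightarrow> real) \<Rightarrow> real \<Rightarrow> bool" where
  "gaussian_white_noise M x var \<longleftrightarrow> gaussian_process M x \<and> white_noise M x var"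

definition in_neighbours :: "((real fps)^'l^'l) \<Rightarrow> 'l::finite \<Rightarrow> 'l set" where
  "in_neighbours G j = {k. G $ j $ k \<noteq> 0}"

(* All principal minors of I - G are nonzero at z = infinity. *)
definition well_posed :: "((real fps)^'l^'l::finite) \<Rightarrow> bool" where
  "well_posed G \<longleftrightarrow> (\<forall>S::'l set.
     det (\<chi> k l. if k \<in> S \<and> l \<in> S then fps_nth ((mat 1 - G) $ k $ l) 0
                 else if k = l then 1 else 0 :: real^'l^'l) \<noteq> 0)"

(* The equation  w_k(t) = (sum over l in N_k of G_kl(q) w_l(t)) + r_k(t) + v_k(t)  almost
   surely at all times.  An unstable G_kl has a diverging impulse response, so the series
   for G_kl(q) w_l(t) need not converge; as usual for rational operators, the equation is
   read as the difference equation obtained by clearing denominators, for every polynomial d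
   that makes all d * G_kl polynomial.  The response w = (I - G)^-1 (r + v) through a stable
   (I - G)^-1 satisfies it; among its solutions, mean_bounded (w k) excludes those that contain
   freely evolving unstable modes. *)
definition node_equation ::
  "'a measure \<Rightarrow> ((real fps)^'l^'l) \<Rightarrow> ('l \<Rightarrow> int \<Rightarrow> 'a \<Rightarrow> real) \<Rightarrow> ('l \<Rightarrow> int \<Rightarrow> 'a \<Rightarrow> real) \<Rightarrow>
   ('l \<Rightarrow> int \<Rightarrow> 'a \<Rightarrow> real) \<Rightarrow> 'l::finite \<Rightarrow> bool" where
  "node_equation M G w r v k \<longleftrightarrow>
     (\<forall>d p. (\<forall>l. fps_of_poly d * G $ k $ l = fps_of_poly (p l)) \<longrightarrow>
        (\<forall>t. AE \<omega> in M. filt (fps_of_poly d) (w k) t \<omega> =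
           (\<Sum>l\<in>in_neighbours G k. filt (fps_of_poly (p l)) (w l) t \<omega>)
           + filt (fps_of_poly d) (\<lambda>t \<omega>. r k t \<omega> + v k t \<omega>) t \<omega>))"

end

theory Submission
  imports Defs "HOL-Complex_Analysis.Complex_Analysis"
begin

text \<open>
  Put \<open>K = (1 - Mj) (1 + Fbar) = H\<^sup>-\<^sup>1 F_a / F_a_star\<close>. This filter is stable, because its
  denominator has the mirrored roots, and applying it to the node equation cancels the unstable
  factors of every \<open>F j k\<close>: the module \<open>G j k\<close> turns into \<open>Mjk k\<close>, and for \<open>k = i\<close> into
  \<open>(1 - Mj) B j i\<close>. The noise becomes \<open>F_a / F_a_star\<close> applied to \<open>e\<close>. A polynomial and its
  reflection have the same modulus on the unit circle, so \<open>F_a / F_a_star\<close> is all-pass with gain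
  \<open>\<bar>lead_coeff F_a\<bar>\<close> and maps white noise to white noise; normality survives because limits of
  centred normal variables with converging variances are normal.
\<close>

section \<open>Stable transfer functions\<close>

text \<open>The modules may be unstable, so \<open>G j k\<close> cannot act on \<open>w k\<close>
  through its impulse response; the node equation is available only after multiplication by a
  polynomial \<open>d\<close>. Hence \<open>K\<close> is split as \<open>L * d\<close> with
  \<open>d\<close> the product of all \<open>F j k\<close>: the difference equation is taken for
  this \<open>d\<close>, and the stable filter
  \<open>L = H^-1 / (F_a_star * product of the Fs k)\<close> is applied to it afterwards. The other
  obstacle is analytic. A filtered path is an infinite series, so composing and adding filters needs
  convergence. A stable filter has an absolutely summable impulse response, and almost every path of
  a signal of bounded mean absolute value is absolutely summable against it, at all times at once.
  The algebra can then be done path by path, off one null set. The gain comes from normalisation: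
  the reflection of \<open>F_a\<close> has constant coefficient \<open>lead_coeff F_a\<close>, and
  the mirrored polynomial is that reflection made monic in the delay. The excitation
  \<open>r j\<close> passes through the same filter \<open>K\<close>; the form without such a term
  is the case where \<open>r j\<close> vanishes.\<close>

lemma stable_roots_iff:
  assumes "coeff p 0 \<noteq> 0"
  shows "stable_roots p \<longleftrightarrow> (\<forall>x. poly (map_poly complex_of_real p) x = 0 \<longrightarrow> cmod x > 1)"
proof -
  have nz: "x \<noteq> 0" if "poly (map_poly complex_of_real p) x = 0" for x
    using that assms by (auto simp: poly_0_coeff_0 coeff_map_poly)
  show ?thesis
  proof
    assume s: "stable_roots p"
    show "\<forall>x. poly (map_poly complex_of_real p) x = 0 \<longrightarrow> cmod x > 1"
    proof (intro allI impI)
      fix x assume x: "poly (map_poly complex_of_real p) x = 0"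
      then have "z_root p (inverse x)" using nz[OF x] by (simp add: z_root_def)
      then have "cmod (inverse x) < 1" using s by (auto simp: stable_roots_def)
      then show "cmod x > 1" using nz[OF x]
        by (simp add: norm_inverse inverse_less_1_iff)
    qed
  next
    assume r: "\<forall>x. poly (map_poly complex_of_real p) x = 0 \<longrightarrow> cmod x > 1"
    show "stable_roots p"
      unfolding stable_roots_def
    proof (intro allI impI)
      fix z assume z: "z_root p z"
      then have "cmod (inverse z) > 1" using r by (auto simp: z_root_def)
      then show "cmod z < 1" using z by (auto simp: z_root_def norm_inverse one_less_inverse_iff)
    qed
  qed
qed

lemma map_poly_of_real_mult:
  "map_poly complex_of_real (p * q) = map_poly complex_of_real p * map_poly complex_of_real q"
  by (rule poly_eqI) (simp add: coeff_map_poly coeff_mult)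

lemma stable_roots_1: "stable_roots 1"
  by (simp add: stable_roots_def z_root_def)

lemma stable_roots_mult: "stable_roots p \<Longrightarrow> stable_roots q \<Longrightarrow> stable_roots (p * q)"
  by (auto simp: stable_roots_def z_root_def map_poly_of_real_mult)

lemma stable_roots_prod:
  "(\<And>k. k \<in> A \<Longrightarrow> stable_roots (p k)) \<Longrightarrow> stable_roots (\<Prod>k\<in>A. p k)"
  by (induction A rule: infinite_finite_induct) (auto simp: stable_roots_1 stable_roots_mult)

lemma monic_in_delay_prod:
  "(\<And>k. k \<in> A \<Longrightarrow> monic_in_delay (p k)) \<Longrightarrow> monic_in_delay (\<Prod>k\<in>A. p k)"
  by (induction A rule: infinite_finite_induct) (auto simp: monic_in_delay_def coeff_mult)

lemma monic_in_delay_mirror_poly: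
  assumes "monic_in_delay p"
  shows "monic_in_delay (mirror_poly p)"
proof -
  have "p \<noteq> 0" using assms by (auto simp: monic_in_delay_def)
  then show ?thesis by (simp add: monic_in_delay_def mirror_poly_def)
qed

lemma stable_roots_mirror_poly:
  assumes "monic_in_delay p" "antistable_roots p"
  shows "stable_roots (mirror_poly p)"
  unfolding stable_roots_def
proof (intro allI impI)
  fix z assume "z_root (mirror_poly p) z"
  then have z: "z \<noteq> 0" and
    r: "poly (map_poly complex_of_real (mirror_poly p)) (inverse z) = 0"
    by (auto simp: z_root_def)
  have p: "p \<noteq> 0" using assms(1) by (auto simp: monic_in_delay_def)
  have "map_poly complex_of_real (mirror_poly p) =
      smult (of_real (inverse (lead_coeff p))) (reflect_poly (map_poly complex_of_real p))"
    by (rule poly_eqI) (simp add: mirror_poly_def coeff_map_poly coeff_reflect_poly degree_map_poly)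
  with r p z have "poly (map_poly complex_of_real p) z = 0"
    by (simp add: poly_reflect_poly_nz)
  then have "z_root p (inverse z)" using z by (simp add: z_root_def)
  then have "cmod (inverse z) > 1" using assms(2) by (auto simp: antistable_roots_def)
  then show "cmod z < 1" using z by (simp add: norm_inverse one_less_inverse_iff)
qed

lemma mirror_poly_mult: "mirror_poly (p * q) = mirror_poly p * mirror_poly q"
  by (simp add: mirror_poly_def reflect_poly_mult lead_coeff_mult mult_ac)

text \<open>Makes \<open>F_a_star\<close>, given factor by factor, the mirror of the single
  polynomial \<open>F_a\<close>, which is the form the all-pass argument works with.\<close>

lemma mirror_poly_prod: "mirror_poly (\<Prod>k\<in>A. p k) = (\<Prod>k\<in>A. mirror_poly (p k))"
  by (induction A rule: infinite_finite_induct)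
    (simp_all add: mirror_poly_mult, simp_all add: mirror_poly_def)

section \<open>Closure properties of stable transfer functions\<close>

lemma stable_tf_poly: "stable_tf (fps_of_poly p)"
  unfolding stable_tf_def
  by (intro exI[of _ p] exI[of _ 1]) (simp add: stable_roots_1)

lemma stable_tf_divide:
  assumes "coeff d 0 \<noteq> 0" "stable_roots d"
  shows "stable_tf (fps_of_poly p / fps_of_poly d)"
  using assms unfolding stable_tf_def by blast

lemma stable_tf_mult:
  assumes "stable_tf g" "stable_tf h"
  shows "stable_tf (g * h)"
proof -
  obtain p d where d: "coeff d 0 \<noteq> 0" "stable_roots d" "g = fps_of_poly p / fps_of_poly d"
    using assms(1) by (auto simp: stable_tf_def)
  obtain p' d' where d': "coeff d' 0 \<noteq> 0" "stable_roots d'" "h = fps_of_poly p' / fps_of_poly d'"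
    using assms(2) by (auto simp: stable_tf_def)
  have "g * h = fps_of_poly (p * p') / fps_of_poly (d * d')"
    using d(1) d'(1) unfolding d(3) d'(3)
    by (simp add: fps_of_poly_mult fps_divide_unit fps_inverse_mult)
  then show ?thesis
    using d d' by (auto intro!: stable_tf_divide stable_roots_mult simp: coeff_mult)
qed

lemma stable_tf_diff:
  assumes "stable_tf g" "stable_tf h"
  shows "stable_tf (g - h)"
proof -
  obtain p d where d: "coeff d 0 \<noteq> 0" "stable_roots d" "g = fps_of_poly p / fps_of_poly d"
    using assms(1) by (auto simp: stable_tf_def)
  obtain p' d' where d': "coeff d' 0 \<noteq> 0" "stable_roots d'" "h = fps_of_poly p' / fps_of_poly d'"
    using assms(2) by (auto simp: stable_tf_def)
  let ?D = "fps_of_poly d" and ?D' = "fps_of_poly d'"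
  have u: "?D * inverse ?D = 1" "?D' * inverse ?D' = 1"
    using d(1) d'(1) by (simp_all add: inverse_mult_eq_1')
  have "g - h = (fps_of_poly p * ?D' - fps_of_poly p' * ?D) / (?D * ?D')"
  proof -
    have "(fps_of_poly p * ?D' - fps_of_poly p' * ?D) / (?D * ?D') =
      fps_of_poly p * inverse ?D * (?D' * inverse ?D') -
      fps_of_poly p' * inverse ?D' * (?D * inverse ?D)"
      using d(1) d'(1) by (simp add: fps_divide_unit fps_inverse_mult algebra_simps)
    then show ?thesis using d(1) d'(1) unfolding d(3) d'(3) u by (simp add: fps_divide_unit)
  qed
  also have "\<dots> = fps_of_poly (p * d' - p' * d) / fps_of_poly (d * d')"
    by (simp add: fps_of_poly_mult fps_of_poly_diff)
  finally show ?thesis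
    using d d' by (auto intro!: stable_tf_divide stable_roots_mult simp: coeff_mult)
qed

lemma stable_tf_1: "stable_tf 1"
  using stable_tf_poly[of 1] by simp

lemma stable_tf_inverse:
  assumes "minimum_phase h"
  shows "stable_tf (inverse h)"
proof -
  obtain p d where d: "coeff p 0 \<noteq> 0" "coeff d 0 \<noteq> 0" "stable_roots p"
    "h = fps_of_poly p / fps_of_poly d"
    using assms by (auto simp: minimum_phase_def)
  have "h * (fps_of_poly d / fps_of_poly p) =
      (fps_of_poly p * inverse (fps_of_poly p)) * (fps_of_poly d * inverse (fps_of_poly d))"
    using d by (simp add: fps_divide_unit algebra_simps)
  also have "\<dots> = 1" using d by (simp add: inverse_mult_eq_1')
  finally have "inverse h = fps_of_poly d / fps_of_poly p"
    by (rule fps_inverse_unique)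
  then show ?thesis using d by (auto intro: stable_tf_divide)
qed

text \<open>Bounded-input bounded-output stability.\<close>

abbreviation bibo :: "real fps \<Rightarrow> bool" where
  "bibo g \<equiv> summable (\<lambda>n. \<bar>fps_nth g n\<bar>)"

lemma bibo_mult_abs:
  assumes "bibo g" "bibo h"
  shows "summable (\<lambda>m. \<Sum>n\<le>m. \<bar>fps_nth g n\<bar> * \<bar>fps_nth h (m - n)\<bar>)"
  using summable_Cauchy_product[of "\<lambda>n. \<bar>fps_nth g n\<bar>" "\<lambda>n. \<bar>fps_nth h n\<bar>"] assms by simp

lemma bibo_mult:
  assumes "bibo g" "bibo h"
  shows "bibo (g * h)"
proof (rule summable_comparison_test[OF _ bibo_mult_abs[OF assms]], intro exI allI impI)
  fix m
  show "norm \<bar>fps_nth (g * h) m\<bar> \<le> (\<Sum>n\<le>m. \<bar>fps_nth g n\<bar> * \<bar>fps_nth h (m - n)\<bar>)"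
    by (auto simp: fps_mult_nth atLeast0AtMost abs_mult[symmetric] intro: sum_abs)
qed

lemma bibo_poly: "bibo (fps_of_poly p)"
  by (rule summable_finite[of "{..degree p}"]) (auto simp: coeff_eq_0)

text \<open>In the delay variable the finitely many roots of the denominator all lie strictly
  outside the unit circle. The complex power series of its reciprocal therefore has radius of
  convergence above 1 and converges absolutely at 1.\<close>

lemma bibo_stable_tf:
  assumes "stable_tf g"
  shows "bibo g"
proof -
  obtain p d where d: "coeff d 0 \<noteq> 0" "stable_roots d" "g = fps_of_poly p / fps_of_poly d"
    using assms by (auto simp: stable_tf_def)
  define D where "D = map_poly complex_of_real d"
  have D0: "D \<noteq> 0" using d(1) by (auto simp: D_def poly_eq_iff coeff_map_poly)
  \<comment> \<open>The extra element 2 keeps the set nonempty when \<open>D\<close> is constant;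
    any number above 1 would do.\<close>
  define R where "R = insert 2 (cmod ` {x. poly D x = 0})"
  have fin: "finite R" using poly_roots_finite[OF D0] by (simp add: R_def)
  have "Min R \<in> R" using fin by (intro Min_in) (auto simp: R_def)
  then have r1: "Min R > 1" using d(1,2) by (auto simp: R_def stable_roots_iff D_def)
  have "fps_conv_radius (inverse (fps_of_poly D)) \<ge> min (ereal (Min R)) (fps_conv_radius (fps_of_poly D))"
  proof (rule fps_conv_radius_inverse)
    fix z assume "ereal (cmod z) < ereal (Min R)"
    then show "eval_fps (fps_of_poly D) z \<noteq> 0"
      using fin by (auto simp: R_def Min_gr_iff)
  qed
  then have "ereal (Min R) \<le> fps_conv_radius (inverse (fps_of_poly D))" by simp
  moreover have "ereal (norm (1::complex)) < ereal (Min R)" using r1 by simp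
  ultimately have "ereal (norm (1::complex)) < fps_conv_radius (inverse (fps_of_poly D))"
    by (rule less_le_trans[rotated])
  from norm_summable_fps[OF this]
  have s: "summable (\<lambda>n. norm (fps_nth (inverse (fps_of_poly D)) n))" by simp
  \<comment> \<open>Back to real coefficients: the embedded real reciprocal is also an inverse of
    \<open>D\<close>, and inverses are unique.\<close>
  have "fps_of_poly D * Abs_fps (\<lambda>n. of_real (fps_nth (inverse (fps_of_poly d)) n)) =
      Abs_fps (\<lambda>n. of_real (fps_nth (fps_of_poly d * inverse (fps_of_poly d)) n))"
    by (rule fps_ext) (simp add: fps_mult_nth D_def coeff_map_poly)
  also have "\<dots> = 1"
    using d(1) by (intro fps_ext) (simp add: inverse_mult_eq_1')
  finally have "inverse (fps_of_poly D) = Abs_fps (\<lambda>n. of_real (fps_nth (inverse (fps_of_poly d)) n))"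
    by (rule fps_inverse_unique)
  with s have "bibo (inverse (fps_of_poly d))" by simp
  then have "bibo (fps_of_poly p * inverse (fps_of_poly d))"
    by (intro bibo_mult bibo_poly)
  then show ?thesis using d by (simp add: fps_divide_unit)
qed

section \<open>Filtering signals of bounded mean\<close>

abbreviation filt_conv :: "real fps \<Rightarrow> (int \<Rightarrow> 'a \<Rightarrow> real) \<Rightarrow> int \<Rightarrow> 'a \<Rightarrow> bool" where
  "filt_conv g x t \<omega> \<equiv> summable (\<lambda>n. \<bar>fps_nth g n * x (t - int n) \<omega>\<bar>)"

text \<open>By monotone convergence the expected sum of absolute values is at most \<open>C\<close>
  times the l1 norm of \<open>g\<close>, so the sum is almost surely finite. One null set serves all
  \<open>t\<close>, since time is countable.\<close>

lemma AE_filt_conv: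
  assumes x: "mean_bounded M x" and g: "bibo g"
  shows "AE \<omega> in M. \<forall>t. filt_conv g x t \<omega>"
  unfolding AE_all_countable
proof
  fix t
  obtain C where C: "\<And>t. (LINT \<omega>|M. \<bar>x t \<omega>\<bar>) \<le> C" and int: "\<And>t. integrable M (x t)"
    using x by (auto simp: mean_bounded_def)
  have [measurable]: "\<And>t. x t \<in> borel_measurable M" using int by auto
  have "0 \<le> C" by (rule order_trans[OF _ C[of 0]]) simp
  let ?f = "\<lambda>n \<omega>. \<bar>fps_nth g n * x (t - int n) \<omega>\<bar>"
  have "(\<integral>\<^sup>+\<omega>. (\<Sum>n. ennreal (?f n \<omega>)) \<partial>M) = (\<Sum>n. \<integral>\<^sup>+\<omega>. ennreal (?f n \<omega>) \<partial>M)"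
    by (rule nn_integral_suminf) simp
  also have "\<dots> \<le> (\<Sum>n. ennreal (\<bar>fps_nth g n\<bar> * C))"
  proof (intro suminf_le)
    fix n
    have "(\<integral>\<^sup>+\<omega>. ennreal (?f n \<omega>) \<partial>M) = ennreal (LINT \<omega>|M. ?f n \<omega>)"
      by (rule nn_integral_eq_integral) (auto intro!: int)
    also have "(LINT \<omega>|M. ?f n \<omega>) = \<bar>fps_nth g n\<bar> * (LINT \<omega>|M. \<bar>x (t - int n) \<omega>\<bar>)"
      by (simp add: abs_mult)
    also have "\<dots> \<le> \<bar>fps_nth g n\<bar> * C" by (intro mult_left_mono C) auto
    finally show "(\<integral>\<^sup>+\<omega>. ennreal (?f n \<omega>) \<partial>M) \<le> ennreal (\<bar>fps_nth g n\<bar> * C)"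
      by (simp add: ennreal_leI)
  qed auto
  also have "\<dots> < \<infinity>"
    using summable_mult2[OF g, of C] \<open>0 \<le> C\<close>
    by (subst suminf_ennreal2) (auto simp: ennreal_less_top)
  finally have "AE \<omega> in M. (\<Sum>n. ennreal (?f n \<omega>)) \<noteq> \<infinity>"
    by (intro nn_integral_noteq_infinite) auto
  then show "AE \<omega> in M. summable (\<lambda>n. ?f n \<omega>)"
    by eventually_elim (auto intro: summable_suminf_not_top)
qed

text \<open>Fubini for the double series over two successive delays. Assumption \<open>c\<close> is
  its absolute convergence, with terms grouped by total delay.\<close>

lemma filt_mult:
  assumes c: "summable (\<lambda>m. (\<Sum>n\<le>m. \<bar>fps_nth g n\<bar> * \<bar>fps_nth h (m - n)\<bar>) * \<bar>x (t - int m) \<omega>\<bar>)"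
    and h: "\<And>s. filt_conv h x s \<omega>"
  shows "filt_conv g (filt h x) t \<omega>" "filt (g * h) x t \<omega> = filt g (filt h x) t \<omega>"
proof -
  \<comment> \<open>\<open>\<phi>\<close> is indexed by the total delay and its share in
    \<open>g\<close>, \<open>\<psi>\<close> by the two separate delays; \<open>m = n + k\<close>
    links them. Summing \<open>\<phi>\<close> gives the product filter, summing
    \<open>\<psi>\<close> the composition.\<close>
  define \<phi> where "\<phi> = (\<lambda>(m, n). fps_nth g n * fps_nth h (m - n) * x (t - int m) \<omega>)"
  define \<psi> where "\<psi> = (\<lambda>(n, k). fps_nth g n * (fps_nth h k * x (t - int n - int k) \<omega>))"
  let ?S = "SIGMA m:UNIV. {..m::nat}"
  have inner: "(\<Sum>n\<le>m. norm (\<phi> (m, n))) =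
      (\<Sum>n\<le>m. \<bar>fps_nth g n\<bar> * \<bar>fps_nth h (m - n)\<bar>) * \<bar>x (t - int m) \<omega>\<bar>" for m
    by (simp add: \<phi>_def sum_distrib_right abs_mult)
  have abs\<phi>: "(\<lambda>z. norm (\<phi> z)) summable_on ?S"
  proof (rule Infinite_Sum.abs_summable_on_Sigma_iff[THEN iffD2], intro conjI ballI)
    show "(\<lambda>m. norm (infsum (\<lambda>n. norm (\<phi> (m, n))) {..m})) summable_on UNIV"
      using c by (simp add: inner[simplified] abs_mult sum_nonneg summable_on_UNIV_nonneg_real_iff)
  qed simp
  have abs\<psi>: "(\<lambda>z. norm (\<psi> z)) summable_on UNIV \<times> UNIV"
    using abs\<phi>
    by (subst summable_on_reindex_bij_witness[where T = ?S and h = "\<lambda>z. norm (\<phi> z)"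
          and i = "\<lambda>(m, n). (n, m - n)" and j = "\<lambda>(n, k). (n + k, n)"])
      (auto simp: \<phi>_def \<psi>_def algebra_simps)
  have eq: "infsum \<psi> (UNIV \<times> UNIV) = infsum \<phi> ?S"
    by (rule infsum_reindex_bij_witness[where i = "\<lambda>(m, n). (n, m - n)" and j = "\<lambda>(n, k). (n + k, n)"])
      (auto simp: \<phi>_def \<psi>_def algebra_simps)
  have suminf: "infsum f UNIV = suminf f" if "summable (\<lambda>n. \<bar>f n\<bar>)" for f :: "nat \<Rightarrow> real"
    using that by (intro infsumI norm_summable_imp_has_sum summable_sums)
      (auto intro: summable_rabs_cancel)
  have row: "infsum (\<lambda>k. \<psi> (n, k)) UNIV = fps_nth g n * filt h x (t - int n) \<omega>" for n
    unfolding \<psi>_def filt_def using h[of "t - int n"]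
    by (subst suminf) (auto simp: abs_mult[of "fps_nth g n"] intro!: summable_mult suminf_mult
        intro: summable_rabs_cancel)
  have "(\<lambda>n. infsum (\<lambda>k. norm (\<psi> (n, k))) UNIV) summable_on UNIV"
    using abs\<psi> unfolding Infinite_Sum.abs_summable_on_Sigma_iff by (simp add: infsum_nonneg)
  then have rows: "summable (\<lambda>n. infsum (\<lambda>k. norm (\<psi> (n, k))) UNIV)"
    by (simp add: summable_on_UNIV_nonneg_real_iff infsum_nonneg)
  show conv: "filt_conv g (filt h x) t \<omega>"
  proof (rule summable_comparison_test[OF _ rows], intro exI allI impI)
    fix n
    show "norm \<bar>fps_nth g n * filt h x (t - int n) \<omega>\<bar> \<le> infsum (\<lambda>k. norm (\<psi> (n, k))) UNIV"
      using abs\<psi> norm_infsum_bound[of "\<lambda>k. \<psi> (n, k)" UNIV]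
      unfolding Infinite_Sum.abs_summable_on_Sigma_iff row by auto
  qed
  have col: "infsum (\<lambda>n. \<phi> (m, n)) {..m} = fps_nth (g * h) m * x (t - int m) \<omega>" for m
    by (simp add: \<phi>_def fps_mult_nth atLeast0AtMost sum_distrib_right)
  have "filt (g * h) x t \<omega> = infsum (\<lambda>m. infsum (\<lambda>n. \<phi> (m, n)) {..m}) UNIV"
    unfolding filt_def col
  proof (rule suminf[symmetric], rule summable_comparison_test[OF _ c], intro exI allI impI)
    fix m
    show "norm \<bar>fps_nth (g * h) m * x (t - int m) \<omega>\<bar>
        \<le> (\<Sum>n\<le>m. \<bar>fps_nth g n\<bar> * \<bar>fps_nth h (m - n)\<bar>) * \<bar>x (t - int m) \<omega>\<bar>"
      using mult_right_mono[OF sum_abs[of "\<lambda>n. fps_nth g n * fps_nth h (m - n)" "{..m}"],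
          of "\<bar>x (t - int m) \<omega>\<bar>"]
      by (simp add: abs_mult fps_mult_nth atLeast0AtMost)
  qed
  also have "\<dots> = infsum \<phi> ?S"
    by (rule infsum_Sigma_banach[OF abs_summable_summable[OF abs\<phi>]])
  also have "\<dots> = infsum \<psi> (UNIV \<times> UNIV)"
    by (rule eq[symmetric])
  also have "\<dots> = infsum (\<lambda>n. infsum (\<lambda>k. \<psi> (n, k)) UNIV) UNIV"
    by (rule infsum_Sigma_banach[OF abs_summable_summable[OF abs\<psi>], symmetric])
  also have "\<dots> = filt g (filt h x) t \<omega>"
    unfolding row filt_def[of g] by (rule suminf[OF conv])
  finally show "filt (g * h) x t \<omega> = filt g (filt h x) t \<omega>" .
qed

lemma AE_filt_mult:
  assumes "mean_bounded M x" "bibo g" "bibo h"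
  shows "AE \<omega> in M. \<forall>t. filt_conv g (filt h x) t \<omega> \<and> filt (g * h) x t \<omega> = filt g (filt h x) t \<omega>"
proof -
  \<comment> \<open>The convolution of the absolute impulse responses is again a summable filter, so
    its almost sure convergence on \<open>x\<close> is exactly the absolute convergence that
    \<open>filt_mult\<close> asks for.\<close>
  let ?c = "Abs_fps (\<lambda>m. \<Sum>n\<le>m. \<bar>fps_nth g n\<bar> * \<bar>fps_nth h (m - n)\<bar>)"
  have "bibo ?c" using bibo_mult_abs[OF assms(2,3)] by (simp add: sum_nonneg)
  from AE_filt_conv[OF assms(1) this] AE_filt_conv[OF assms(1,3)] show ?thesis
  proof eventually_elim
    case (elim \<omega>)
    then have "summable (\<lambda>m. (\<Sum>n\<le>m. \<bar>fps_nth g n\<bar> * \<bar>fps_nth h (m - n)\<bar>) * \<bar>x (t - int m) \<omega>\<bar>)" for t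
      by (simp add: abs_mult sum_nonneg)
    from filt_mult[where g = g and h = h and x = x and \<omega> = \<omega>, OF this] elim show ?case by blast
  qed
qed

section \<open>Linearity of filtering\<close>

lemma filt_1: "filt 1 x t \<omega> = x t \<omega>"
  using suminf_finite[of "{0}" "\<lambda>n. fps_nth 1 n * x (t - int n) \<omega>"] by (simp add: filt_def)

lemma filt_add:
  assumes "filt_conv g x t \<omega>" "filt_conv g y t \<omega>"
  shows "filt g (\<lambda>t \<omega>. x t \<omega> + y t \<omega>) t \<omega> = filt g x t \<omega> + filt g y t \<omega>"
  unfolding filt_def distrib_left
  using assms[THEN summable_rabs_cancel] by (rule suminf_add[symmetric])

lemma filt_conv_add:
  assumes "filt_conv g x t \<omega>" "filt_conv g y t \<omega>"
  shows "filt_conv g (\<lambda>t \<omega>. x t \<omega> + y t \<omega>) t \<omega>"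
proof (rule summable_comparison_test[OF _ summable_add[OF assms]], intro exI allI impI)
  fix n
  show "norm \<bar>fps_nth g n * (x (t - int n) \<omega> + y (t - int n) \<omega>)\<bar>
      \<le> \<bar>fps_nth g n * x (t - int n) \<omega>\<bar> + \<bar>fps_nth g n * y (t - int n) \<omega>\<bar>"
    by (simp add: distrib_left)
qed

lemma filt_sum:
  assumes "\<And>l. l \<in> A \<Longrightarrow> filt_conv g (x l) t \<omega>"
  shows "filt g (\<lambda>t \<omega>. \<Sum>l\<in>A. x l t \<omega>) t \<omega> = (\<Sum>l\<in>A. filt g (x l) t \<omega>)"
  unfolding filt_def sum_distrib_left
  by (rule suminf_sum, rule summable_rabs_cancel, rule assms)

lemma filt_conv_sum:
  assumes "\<And>l. l \<in> A \<Longrightarrow> filt_conv g (x l) t \<omega>"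
  shows "filt_conv g (\<lambda>t \<omega>. \<Sum>l\<in>A. x l t \<omega>) t \<omega>"
  using assms
proof (induction A rule: infinite_finite_induct)
  case (insert l A)
  then show ?case
    using filt_conv_add[of g "x l" t \<omega> "\<lambda>t \<omega>. \<Sum>l\<in>A. x l t \<omega>"] by simp
qed simp_all

lemma filt_add_left:
  assumes "filt_conv g x t \<omega>" "filt_conv h x t \<omega>"
  shows "filt (g + h) x t \<omega> = filt g x t \<omega> + filt h x t \<omega>"
  unfolding filt_def fps_add_nth distrib_right
  using assms[THEN summable_rabs_cancel] by (rule suminf_add[symmetric])

lemma filt_cong:
  assumes "\<And>s. x s \<omega> = y s \<omega>"
  shows "filt g x t \<omega> = filt g y t \<omega>"
  by (simp add: filt_def assms)

section \<open>Sources of signals of bounded mean\<close>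

lemma mean_bounded_add:
  assumes "mean_bounded M x" "mean_bounded M y"
  shows "mean_bounded M (\<lambda>t \<omega>. x t \<omega> + y t \<omega>)"
proof -
  obtain C D where C: "\<And>t. (LINT \<omega>|M. \<bar>x t \<omega>\<bar>) \<le> C" and D: "\<And>t. (LINT \<omega>|M. \<bar>y t \<omega>\<bar>) \<le> D"
    using assms by (auto simp: mean_bounded_def)
  have int: "integrable M (x t)" "integrable M (y t)" for t
    using assms by (auto simp: mean_bounded_def)
  have "(LINT \<omega>|M. \<bar>x t \<omega> + y t \<omega>\<bar>) \<le> C + D" for t
  proof -
    have "(LINT \<omega>|M. \<bar>x t \<omega> + y t \<omega>\<bar>) \<le> (LINT \<omega>|M. \<bar>x t \<omega>\<bar> + \<bar>y t \<omega>\<bar>)"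
      by (intro integral_mono) (auto intro!: int)
    also have "\<dots> = (LINT \<omega>|M. \<bar>x t \<omega>\<bar>) + (LINT \<omega>|M. \<bar>y t \<omega>\<bar>)"
      by (intro Bochner_Integration.integral_add) (auto intro!: int)
    finally show ?thesis using C[of t] D[of t] by linarith
  qed
  then show ?thesis using int by (auto simp: mean_bounded_def)
qed

text \<open>The bound \<open>\<bar>x\<bar> \<le> 1 + x^2\<close> together with total mass 1 turns a
  uniform second moment into a uniform first absolute moment.\<close>

lemma (in prob_space) mean_bounded_second_order:
  assumes "second_order M x" "\<And>t. (LINT \<omega>|M. x t \<omega> * x t \<omega>) \<le> C"
  shows "mean_bounded M x"
  unfolding mean_bounded_def
proof (intro conjI allI exI)
  fix t
  have m [measurable]: "x t \<in> borel_measurable M" and int2: "integrable M (\<lambda>\<omega>. (x t \<omega>)\<^sup>2)"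
    using assms(1) by (auto simp: second_order_def)
  show int: "integrable M (x t)"
    using square_integrable_imp_integrable[OF m int2] .
  have "(LINT \<omega>|M. \<bar>x t \<omega>\<bar>) \<le> (LINT \<omega>|M. 1 + (x t \<omega>)\<^sup>2)"
  proof (intro integral_mono)
    fix \<omega>
    have "0 \<le> (\<bar>x t \<omega>\<bar> - 1)\<^sup>2" by simp
    then have "2 * \<bar>x t \<omega>\<bar> \<le> 1 + (x t \<omega>)\<^sup>2" by (simp add: power2_diff)
    then show "\<bar>x t \<omega>\<bar> \<le> 1 + (x t \<omega>)\<^sup>2" by linarith
  qed (auto intro!: int int2)
  also have "\<dots> = 1 + (LINT \<omega>|M. x t \<omega> * x t \<omega>)"
    using int2 by (simp add: prob_space power2_eq_square)
  finally show "(LINT \<omega>|M. \<bar>x t \<omega>\<bar>) \<le> 1 + C" using assms(2)[of t] by linarith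
qed

lemma (in prob_space) mean_bounded_stationary:
  assumes "stationary M x"
  shows "mean_bounded M x"
proof (rule mean_bounded_second_order)
  have "\<And>t s d. (LINT \<omega>|M. x (t + d) \<omega> * x t \<omega>) = (LINT \<omega>|M. x (s + d) \<omega> * x s \<omega>)"
    using assms by (simp only: stationary_def)
  from this[of _ 0 0] show "(LINT \<omega>|M. x t \<omega> * x t \<omega>) \<le> (LINT \<omega>|M. x 0 \<omega> * x 0 \<omega>)" for t
    by (intro eq_refl) simp
qed (use assms in \<open>simp add: stationary_def\<close>)

lemma (in prob_space) mean_bounded_white_noise: "white_noise M x s \<Longrightarrow> mean_bounded M x"
  by (rule mean_bounded_second_order[where C = s]) (auto simp: white_noise_def)

section \<open>All-pass filters\<close>

text \<open>The l2 inner product of impulse responses. For a filter driven by white noise,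
  \<open>pairing g (fps_X ^ d * g)\<close> is the output covariance at lag \<open>d\<close> up to
  the input variance. It is the time-domain counterpart of an integral over the unit circle, so no
  Fourier theory enters.\<close>

definition pairing :: "real fps \<Rightarrow> real fps \<Rightarrow> real" where
  "pairing a b = (\<Sum>n. fps_nth a n * fps_nth b n)"

lemma summable_pairing:
  assumes "bibo a" "bibo b"
  shows "summable (\<lambda>n. fps_nth a n * fps_nth b n)"
proof -
  obtain C where C: "\<And>n. \<bar>fps_nth b n\<bar> \<le> C"
    using summable_imp_bounded[OF assms(2)] by (auto simp: bounded_iff)
  show ?thesis
  proof (rule summable_comparison_test[OF _ summable_mult2[OF assms(1), of C]], intro exI allI impI)
    fix n show "norm (fps_nth a n * fps_nth b n) \<le> \<bar>fps_nth a n\<bar> * C"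
      by (simp add: abs_mult mult_left_mono C)
  qed
qed

lemma pairing_shift:
  assumes "bibo a" "bibo b"
  shows "pairing (fps_X ^ k * a) (fps_X ^ k * b) = pairing a b"
proof -
  let ?f = "\<lambda>n. fps_nth (fps_X ^ k * a) n * fps_nth (fps_X ^ k * b) n"
  have f: "?f (n + k) = fps_nth a n * fps_nth b n" for n
    by (simp add: fps_X_power_mult_nth)
  have "summable (\<lambda>n. ?f (n + k))"
    unfolding f by (rule summable_pairing[OF assms])
  then have "summable ?f" by (rule summable_iff_shift[of ?f k, THEN iffD1])
  then have "suminf ?f = (\<Sum>n. ?f (n + k)) + (\<Sum>n<k. ?f n)"
    by (rule suminf_split_initial_segment)
  also have "(\<Sum>n<k. ?f n) = 0" by (simp add: fps_X_power_mult_nth)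
  finally show ?thesis by (simp add: pairing_def f)
qed

text \<open>Bilinearity for finite combinations; with polynomial filters expanded into delays, a
  pairing becomes a quadratic form in the coefficients.\<close>

lemma pairing_sum:
  assumes "\<And>i. i \<in> I \<Longrightarrow> bibo (a i)" "\<And>j. j \<in> J \<Longrightarrow> bibo (b j)"
  shows "pairing (\<Sum>i\<in>I. fps_const (c i) * a i) (\<Sum>j\<in>J. fps_const (d j) * b j) =
    (\<Sum>i\<in>I. \<Sum>j\<in>J. c i * d j * pairing (a i) (b j))"
proof -
  have "pairing (\<Sum>i\<in>I. fps_const (c i) * a i) (\<Sum>j\<in>J. fps_const (d j) * b j) =
      (\<Sum>n. \<Sum>i\<in>I. \<Sum>j\<in>J. c i * d j * (fps_nth (a i) n * fps_nth (b j) n))"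
    by (simp add: pairing_def fps_sum_nth sum_product mult_ac)
  also have "\<dots> = (\<Sum>i\<in>I. \<Sum>n. \<Sum>j\<in>J. c i * d j * (fps_nth (a i) n * fps_nth (b j) n))"
    by (intro suminf_sum summable_sum summable_mult summable_pairing assms)
  also have "\<dots> = (\<Sum>i\<in>I. \<Sum>j\<in>J. \<Sum>n. c i * d j * (fps_nth (a i) n * fps_nth (b j) n))"
    by (intro sum.cong suminf_sum summable_sum summable_mult summable_pairing assms refl)
  also have "\<dots> = (\<Sum>i\<in>I. \<Sum>j\<in>J. c i * d j * pairing (a i) (b j))"
    unfolding pairing_def by (intro sum.cong suminf_mult summable_pairing assms refl)
  finally show ?thesis .
qed

lemma fps_of_poly_times_eq_sum:
  fixes p :: "'a::comm_ring_1 poly"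
  assumes "degree p \<le> n"
  shows "fps_of_poly p * a = (\<Sum>i\<le>n. fps_const (coeff p i) * (fps_X ^ i * a))"
proof -
  have "fps_of_poly p = fps_of_poly (\<Sum>i\<le>n. monom (coeff p i) i)"
    by (subst poly_as_sum_of_monoms'[OF assms]) simp
  also have "\<dots> = (\<Sum>i\<le>n. fps_const (coeff p i) * fps_X ^ i)"
    by (simp add: fps_of_poly_sum fps_of_poly_monom)
  finally show ?thesis by (simp add: sum_distrib_right mult.assoc)
qed

text \<open>On the unit circle a real polynomial and its reflection have the same modulus.\<close>

lemma pairing_reflect_poly:
  assumes a: "bibo a" and b: "bibo b"
  shows "pairing (fps_of_poly (reflect_poly p) * a) (fps_of_poly (reflect_poly p) * b) =
    pairing (fps_of_poly p * a) (fps_of_poly p * b)"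
proof -
  define n where "n = degree p"
  \<comment> \<open>The matrix of pairings of delayed copies of \<open>a\<close> and
    \<open>b\<close>. It is Toeplitz because a common delay does not change a pairing, but not
    symmetric in general, as \<open>a\<close> and \<open>b\<close> may differ.\<close>
  define T where "T = (\<lambda>i j. pairing (fps_X ^ i * a) (fps_X ^ j * b))"
  have bibo_X: "bibo (fps_X ^ i * a)" if "bibo a" for i a
    using bibo_mult[OF bibo_poly[of "monom 1 i"] that] by (simp add: fps_of_poly_monom)
  have T_shift: "T (i + k) (j + k) = T i j" for i j k
    using pairing_shift[OF bibo_X[OF a] bibo_X[OF b], of k i j]
    by (simp add: T_def power_add mult_ac)
  \<comment> \<open>Reversing both indices of a Toeplitz matrix transposes it: both sides equal the
    entry at \<open>(n + j, n + i)\<close>. The transposition is then absorbed by swapping the two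
    summation indices, as the coefficient product is symmetric.\<close>
  have T_reflect: "T (n - i) (n - j) = T j i" if "i \<le> n" "j \<le> n" for i j
    using T_shift[of "n - i" "i + j" "n - j"] T_shift[of j n i] that by (simp add: add_ac)
  have exp: "pairing (fps_of_poly q * a) (fps_of_poly q * b) =
      (\<Sum>i\<le>n. \<Sum>j\<le>n. coeff q i * coeff q j * T i j)" if "degree q \<le> n" for q
    unfolding fps_of_poly_times_eq_sum[OF that] T_def
    by (rule pairing_sum) (intro bibo_X a b)+
  have c: "coeff (reflect_poly p) i = coeff p (n - i)" if "i \<le> n" for i
    using that by (simp add: coeff_reflect_poly n_def)
  have rev: "(\<Sum>i\<le>n. f (n - i)) = (\<Sum>i\<le>n. f i)" for f :: "nat \<Rightarrow> real"
    by (rule sum.reindex_bij_witness[where i = "\<lambda>i. n - i" and j = "\<lambda>i. n - i"]) auto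
  have "pairing (fps_of_poly (reflect_poly p) * a) (fps_of_poly (reflect_poly p) * b) =
      (\<Sum>i\<le>n. \<Sum>j\<le>n. coeff p (n - i) * coeff p (n - j) * T i j)"
    by (subst exp) (auto simp: c degree_reflect_poly_le[of p, folded n_def] intro!: sum.cong)
  also have "\<dots> = (\<Sum>i\<le>n. \<Sum>j\<le>n. coeff p (n - i) * coeff p j * T i (n - j))"
    by (subst rev[symmetric]) (auto intro!: sum.cong)
  also have "\<dots> = (\<Sum>i\<le>n. \<Sum>j\<le>n. coeff p i * coeff p j * T (n - i) (n - j))"
    by (subst rev[symmetric]) (auto intro!: sum.cong)
  also have "\<dots> = (\<Sum>i\<le>n. \<Sum>j\<le>n. coeff p i * coeff p j * T j i)"
    by (auto simp: T_reflect intro!: sum.cong)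
  also have "\<dots> = (\<Sum>i\<le>n. \<Sum>j\<le>n. coeff p i * coeff p j * T i j)"
    by (subst sum.swap) (simp add: mult.commute)
  also have "\<dots> = pairing (fps_of_poly p * a) (fps_of_poly p * b)"
    by (simp add: exp n_def)
  finally show ?thesis .
qed

text \<open>The pairing does not change when the numerator \<open>p\<close> is replaced by its
  reflection. The reflection is \<open>lead_coeff p\<close> times the denominator, so the filter
  collapses to that constant, which is orthogonal to its own nonzero delays.\<close>

lemma pairing_all_pass:
  assumes p: "coeff p 0 \<noteq> 0" and h: "bibo (inverse (fps_of_poly (mirror_poly p)))"
    and g: "g = fps_of_poly p / fps_of_poly (mirror_poly p)"
  shows "pairing g (fps_X ^ d * g) = (if d = 0 then (lead_coeff p)\<^sup>2 else 0)"
proof -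
  let ?c = "lead_coeff p" and ?h = "inverse (fps_of_poly (mirror_poly p))"
  have c: "?c \<noteq> 0" using p by auto
  then have m: "coeff (mirror_poly p) 0 \<noteq> 0" by (simp add: mirror_poly_def)
  have "reflect_poly p = smult ?c (mirror_poly p)" using c by (simp add: mirror_poly_def)
  then have r: "fps_of_poly (reflect_poly p) * ?h = fps_const ?c"
    using m by (simp add: fps_of_poly_smult mult.assoc inverse_mult_eq_1')
  have bX: "bibo (fps_X ^ d * ?h)"
    using bibo_mult[OF bibo_poly[of "monom 1 d"] h] by (simp add: fps_of_poly_monom)
  have "pairing g (fps_X ^ d * g) = pairing (fps_of_poly p * ?h) (fps_of_poly p * (fps_X ^ d * ?h))"
    using m by (simp add: g fps_divide_unit mult_ac)
  also have "\<dots> = pairing (fps_of_poly (reflect_poly p) * ?h)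
      (fps_of_poly (reflect_poly p) * (fps_X ^ d * ?h))"
    by (rule pairing_reflect_poly[OF h bX, symmetric])
  also have "\<dots> = pairing (fps_const ?c) (fps_X ^ d * fps_const ?c)"
    by (simp only: r mult.left_commute[of _ "fps_X ^ d"])
  also have "\<dots> = (\<Sum>n\<in>{0}. fps_nth (fps_const ?c) n * fps_nth (fps_X ^ d * fps_const ?c) n)"
    unfolding pairing_def by (rule suminf_finite) auto
  also have "\<dots> = (if d = 0 then ?c\<^sup>2 else 0)"
    by (simp add: fps_X_power_mult_nth power2_eq_square)
  finally show ?thesis .
qed

section \<open>Filtered Gaussian white noise\<close>

context prob_space
begin

text \<open>Writing the characteristic function through the second moment treats the normal and the
  degenerate case alike: in the latter the moment is 0 and the function is constantly 1.\<close>

lemma gaussian_rv_imp_char: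
  assumes X: "gaussian_rv M X" and E0: "expectation X = 0"
  shows "char (distr M borel X) u = exp (- (u\<^sup>2 * expectation (\<lambda>\<omega>. (X \<omega>)\<^sup>2) / 2))"
proof -
  have [measurable]: "X \<in> borel_measurable M" using X by (simp add: gaussian_rv_def)
  have ch: "char (distr M borel X) u = (CLINT \<omega>|M. iexp (u * X \<omega>))"
    by (simp add: char_def integral_distr)
  from X consider (normal) m s where "s > 0" "distributed M lborel X (normal_density m s)"
    | (const) m where "AE \<omega> in M. X \<omega> = m"
    by (auto simp: gaussian_rv_def)
  then show ?thesis
  proof cases
    case normal
    have "m = 0" using normal_distributed_expectation[OF normal(1,2)] E0 by simp
    have v: "expectation (\<lambda>\<omega>. (X \<omega>)\<^sup>2) = s\<^sup>2"
      using normal_distributed_variance[OF normal(1,2)] E0 by simp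
    have "distributed M lborel (\<lambda>\<omega>. (X \<omega> - m) / s) std_normal_density"
      using normal normal_standard_normal_convert by blast
    then have Y: "distr M lborel (\<lambda>\<omega>. X \<omega> / s) = std_normal_distribution"
      using \<open>m = 0\<close> by (simp add: distributed_def)
    have "exp (- (u * s)\<^sup>2 / 2) = char std_normal_distribution (u * s)"
      by (simp add: char_std_normal_distribution)
    also have "\<dots> = (CLINT \<omega>|M. iexp ((u * s) * (X \<omega> / s)))"
      unfolding Y[symmetric] char_def by (subst integral_distr) simp_all
    also have "\<dots> = char (distr M borel X) u"
    proof -
      have "(u * s) * (X \<omega> / s) = u * X \<omega>" for \<omega> using normal(1) by simp
      then show ?thesis by (simp only: ch)
    qed
    finally show ?thesis by (simp add: v power_mult_distrib)
  next
    case const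
    have "expectation X = expectation (\<lambda>_. m)" using const by (intro integral_cong_AE) auto
    then have "m = 0" using E0 by (simp add: prob_space)
    have "expectation (\<lambda>\<omega>. (X \<omega>)\<^sup>2) = expectation (\<lambda>_. 0)"
      using const \<open>m = 0\<close> by (intro integral_cong_AE) auto
    moreover have "(CLINT \<omega>|M. iexp (u * X \<omega>)) = (CLINT \<omega>|M. 1)"
      using const \<open>m = 0\<close> by (intro integral_cong_AE) auto
    ultimately show ?thesis by (simp add: ch prob_space)
  qed
qed

text \<open>A zero second moment forces an almost surely zero variable. Otherwise dividing by the
  standard deviation gives the standard normal characteristic function, and Levy uniqueness
  identifies the law.\<close>

lemma gaussian_rv_if_char:
  assumes [measurable]: "X \<in> borel_measurable M"
    and int: "integrable M (\<lambda>\<omega>. (X \<omega>)\<^sup>2)"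
    and char: "\<And>u. char (distr M borel X) u = exp (- (u\<^sup>2 * expectation (\<lambda>\<omega>. (X \<omega>)\<^sup>2) / 2))"
  shows "gaussian_rv M X"
proof (cases "expectation (\<lambda>\<omega>. (X \<omega>)\<^sup>2) = 0")
  case True
  then have "AE \<omega> in M. X \<omega> = 0"
    using integral_nonneg_eq_0_iff_AE[OF int] by simp
  then show ?thesis by (auto simp: gaussian_rv_def)
next
  case False
  define s where "s = sqrt (expectation (\<lambda>\<omega>. (X \<omega>)\<^sup>2))"
  have "expectation (\<lambda>\<omega>. (X \<omega>)\<^sup>2) \<ge> 0" by simp
  with False have "expectation (\<lambda>\<omega>. (X \<omega>)\<^sup>2) > 0" by linarith
  then have s: "s > 0" "s\<^sup>2 = expectation (\<lambda>\<omega>. (X \<omega>)\<^sup>2)" by (auto simp: s_def)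
  have "distr M borel (\<lambda>\<omega>. X \<omega> / s) = std_normal_distribution"
  proof (rule Levy_uniqueness)
    show "real_distribution (distr M borel (\<lambda>\<omega>. X \<omega> / s))" by (rule real_distribution_distr) simp
    show "real_distribution std_normal_distribution" by (rule real_dist_normal_dist)
    show "char (distr M borel (\<lambda>\<omega>. X \<omega> / s)) = char std_normal_distribution"
    proof
      fix u
      have "char (distr M borel (\<lambda>\<omega>. X \<omega> / s)) u = char (distr M borel X) (u / s)"
        by (simp add: char_def integral_distr)
      also have "\<dots> = exp (- u\<^sup>2 / 2)" using s by (simp add: char power_divide flip: s(2))
      finally show "char (distr M borel (\<lambda>\<omega>. X \<omega> / s)) u = char std_normal_distribution u"
        by (simp add: char_std_normal_distribution)
    qed
  qed
  then have "distributed M lborel (\<lambda>\<omega>. X \<omega> / s) std_normal_density"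
    by (simp add: distributed_def cong: distr_cong)
  then have "distributed M lborel (\<lambda>\<omega>. (X \<omega> - 0) / s) std_normal_density" by simp
  then have "distributed M lborel X (normal_density 0 s)"
    using s(1) normal_standard_normal_convert by blast
  then show ?thesis using s(1) by (auto simp: gaussian_rv_def)
qed

text \<open>Characteristic functions converge by dominated convergence with bound 1. For centred
  normal variables they depend only on the second moment, so the limit has the same form.\<close>

lemma gaussian_rv_limit:
  assumes X: "\<And>n. gaussian_rv M (X n)" "\<And>n. expectation (X n) = 0"
    and lim: "AE \<omega> in M. (\<lambda>n. X n \<omega>) \<longlonglongrightarrow> Z \<omega>"
    and Z [measurable]: "Z \<in> borel_measurable M" and int: "integrable M (\<lambda>\<omega>. (Z \<omega>)\<^sup>2)"
    and lim2: "(\<lambda>n. expectation (\<lambda>\<omega>. (X n \<omega>)\<^sup>2)) \<longlonglongrightarrow> expectation (\<lambda>\<omega>. (Z \<omega>)\<^sup>2)"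
  shows "gaussian_rv M Z"
proof (rule gaussian_rv_if_char[OF Z int])
  fix u
  have [measurable]: "\<And>n. X n \<in> borel_measurable M" using X by (simp add: gaussian_rv_def)
  have "(\<lambda>n. CLINT \<omega>|M. iexp (u * X n \<omega>)) \<longlonglongrightarrow> (CLINT \<omega>|M. iexp (u * Z \<omega>))"
  proof (rule integral_dominated_convergence[where w = "\<lambda>_. 1"])
    show "AE \<omega> in M. (\<lambda>n. iexp (u * X n \<omega>)) \<longlonglongrightarrow> iexp (u * Z \<omega>)"
      using lim by eventually_elim (intro tendsto_intros)
  qed auto
  then have "(\<lambda>n. char (distr M borel (X n)) u) \<longlonglongrightarrow> char (distr M borel Z) u"
    by (simp add: char_def integral_distr)
  moreover have "(\<lambda>n. char (distr M borel (X n)) u)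
      \<longlonglongrightarrow> of_real (exp (- (u\<^sup>2 * expectation (\<lambda>\<omega>. (Z \<omega>)\<^sup>2) / 2)))"
    unfolding gaussian_rv_imp_char[OF X] by (intro tendsto_intros lim2) simp_all
  ultimately show "char (distr M borel Z) u = exp (- (u\<^sup>2 * expectation (\<lambda>\<omega>. (Z \<omega>)\<^sup>2) / 2))"
    by (rule LIMSEQ_unique)
qed

end

text \<open>Cauchy-Schwarz with each weight split as \<open>sqrt \<bar>a i\<bar>\<close> times
  itself. For summable weights the right side grows with \<open>I\<close> to a finite limit whenever
  its second series converges, so one bound serves all partial sums.\<close>

lemma square_weighted_sum_le:
  fixes a x :: "'i \<Rightarrow> real"
  shows "(\<Sum>i\<in>I. a i * x i)\<^sup>2 \<le> (\<Sum>i\<in>I. \<bar>a i\<bar>) * (\<Sum>i\<in>I. \<bar>a i\<bar> * (x i)\<^sup>2)"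
proof -
  have "(\<Sum>i\<in>I. a i * x i) = (\<Sum>i\<in>I. (sgn (a i) * sqrt \<bar>a i\<bar>) * (sqrt \<bar>a i\<bar> * x i))"
    by (simp add: mult.assoc[symmetric] mult.assoc[of "sgn _"] sgn_mult_abs)
  also have "\<dots>\<^sup>2 \<le> (\<Sum>i\<in>I. (sgn (a i) * sqrt \<bar>a i\<bar>)\<^sup>2) * (\<Sum>i\<in>I. (sqrt \<bar>a i\<bar> * x i)\<^sup>2)"
    by (rule Cauchy_Schwarz_ineq_sum)
  also have "(\<Sum>i\<in>I. (sgn (a i) * sqrt \<bar>a i\<bar>)\<^sup>2) = (\<Sum>i\<in>I. \<bar>a i\<bar>)"
    by (intro sum.cong) (auto simp: power_mult_distrib sgn_if)
  finally show ?thesis by (simp add: power_mult_distrib)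
qed

section \<open>Moments and normality of filtered white noise\<close>

locale filtered_white_noise = prob_space +
  fixes x :: "int \<Rightarrow> 'a \<Rightarrow> real" and var :: real and g :: "real fps"
  assumes white: "white_noise M x var" and bibo: "bibo g"
begin

definition partial :: "nat \<Rightarrow> int \<Rightarrow> 'a \<Rightarrow> real" where
  "partial m t \<omega> = (\<Sum>n<m. fps_nth g n * x (t - int n) \<omega>)"

text \<open>A majorant, independent of \<open>m\<close>, of the squares of all partial sums at time
  \<open>t\<close>. It is integrable and supplies the bound for every dominated convergence
  below.\<close>

definition envelope :: "int \<Rightarrow> 'a \<Rightarrow> real" where
  "envelope t \<omega> = (\<Sum>n. \<bar>fps_nth g n\<bar>) * (\<Sum>n. \<bar>fps_nth g n\<bar> * (x (t - int n) \<omega>)\<^sup>2)"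

lemma x_measurable [measurable]: "x t \<in> borel_measurable M"
  and x_square_integrable: "integrable M (\<lambda>\<omega>. (x t \<omega>)\<^sup>2)"
  and x_mean: "expectation (x t) = 0"
  and x_cov: "expectation (\<lambda>\<omega>. x t \<omega> * x s \<omega>) = (if t = s then var else 0)"
  using white by (auto simp: white_noise_def second_order_def)

lemma x_integrable: "integrable M (x t)"
  by (rule square_integrable_imp_integrable[OF x_measurable x_square_integrable])

lemma x_prod_integrable: "integrable M (\<lambda>\<omega>. x t \<omega> * x s \<omega>)"
proof (rule Bochner_Integration.integrable_bound[OF
      Bochner_Integration.integrable_add[OF x_square_integrable[of t] x_square_integrable[of s]]])
  have "\<bar>x t \<omega>\<bar> * \<bar>x s \<omega>\<bar> \<le> (x t \<omega>)\<^sup>2 + (x s \<omega>)\<^sup>2" for \<omega>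
    using sum_squares_bound[of "\<bar>x t \<omega>\<bar>" "\<bar>x s \<omega>\<bar>"] mult_nonneg_nonneg[of "\<bar>x t \<omega>\<bar>" "\<bar>x s \<omega>\<bar>"]
    unfolding power2_abs by linarith
  then show "AE \<omega> in M. norm (x t \<omega> * x s \<omega>) \<le> norm ((x t \<omega>)\<^sup>2 + (x s \<omega>)\<^sup>2)"
    by (simp add: abs_mult)
qed measurable

lemma partial_measurable [measurable]: "partial m t \<in> borel_measurable M"
  unfolding partial_def[abs_def] by measurable

lemma filt_measurable [measurable]: "filt g x t \<in> borel_measurable M"
  unfolding filt_def[abs_def] by measurable

text \<open>The squared noise is treated as a signal of its own, so that \<open>AE_filt_conv\<close>
  yields the convergence of the series in \<open>envelope\<close>.\<close>

lemma mean_bounded_square: "mean_bounded M (\<lambda>t \<omega>. (x t \<omega>)\<^sup>2)"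
  unfolding mean_bounded_def using x_square_integrable x_cov
  by (auto intro!: exI[of _ var] simp: power2_eq_square)

lemma AE_envelope:
  "AE \<omega> in M. \<forall>t. summable (\<lambda>n. \<bar>fps_nth g n\<bar> * (x (t - int n) \<omega>)\<^sup>2)"
  using AE_filt_conv[OF mean_bounded_square bibo] by (simp add: abs_mult)

lemma envelope_integrable: "integrable M (envelope t)"
  unfolding envelope_def[abs_def]
proof (rule integrable_mult_right, rule integrable_suminf)
  show "integrable M (\<lambda>\<omega>. \<bar>fps_nth g n\<bar> * (x (t - int n) \<omega>)\<^sup>2)" for n
    by (intro integrable_mult_right x_square_integrable)
  show "AE \<omega> in M. summable (\<lambda>n. norm (\<bar>fps_nth g n\<bar> * (x (t - int n) \<omega>)\<^sup>2))"
    using AE_envelope by eventually_elim (simp add: abs_mult)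
  have norm: "expectation (\<lambda>\<omega>. norm (\<bar>fps_nth g n\<bar> * (x (t - int n) \<omega>)\<^sup>2)) = \<bar>fps_nth g n\<bar> * var" for n
    using x_cov[of "t - int n" "t - int n"] by (simp add: abs_mult power2_eq_square)
  show "summable (\<lambda>n. expectation (\<lambda>\<omega>. norm (\<bar>fps_nth g n\<bar> * (x (t - int n) \<omega>)\<^sup>2)))"
    unfolding norm by (rule summable_mult2[OF bibo])
qed

lemma AE_partial_square_le: "AE \<omega> in M. \<forall>m t. (partial m t \<omega>)\<^sup>2 \<le> envelope t \<omega>"
  using AE_envelope
proof eventually_elim
  case (elim \<omega>)
  show ?case
  proof (intro allI)
    fix m t
    have "(partial m t \<omega>)\<^sup>2 \<le> (\<Sum>n<m. \<bar>fps_nth g n\<bar>) * (\<Sum>n<m. \<bar>fps_nth g n\<bar> * (x (t - int n) \<omega>)\<^sup>2)"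
      unfolding partial_def by (rule square_weighted_sum_le)
    also have "\<dots> \<le> envelope t \<omega>"
      unfolding envelope_def using elim bibo
      by (intro mult_mono sum_le_suminf) (auto intro!: suminf_nonneg sum_nonneg)
    finally show "(partial m t \<omega>)\<^sup>2 \<le> envelope t \<omega>" .
  qed
qed

lemma AE_partial_tendsto: "AE \<omega> in M. \<forall>t. (\<lambda>m. partial m t \<omega>) \<longlonglongrightarrow> filt g x t \<omega>"
  using AE_filt_conv[OF mean_bounded_white_noise[OF white] bibo]
proof eventually_elim
  case (elim \<omega>)
  then show ?case
    unfolding partial_def filt_def by (blast intro: summable_LIMSEQ summable_rabs_cancel)
qed

lemma partial_integrable: "integrable M (partial m t)"
  unfolding partial_def[abs_def] by (simp add: x_integrable)

lemma partial_mean: "expectation (partial m t) = 0"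
  unfolding partial_def[abs_def]
  by (subst Bochner_Integration.integral_sum) (auto intro!: x_integrable simp: x_mean)

lemma partial_cov:
  "expectation (\<lambda>\<omega>. partial m (s + int d) \<omega> * partial m s \<omega>) =
    var * (\<Sum>n<m. fps_nth g n * fps_nth (fps_X ^ d * g) n)"
proof -
  have "expectation (\<lambda>\<omega>. partial m (s + int d) \<omega> * partial m s \<omega>) =
      expectation (\<lambda>\<omega>. \<Sum>n<m. \<Sum>k<m. (fps_nth g n * fps_nth g k) *
        (x (s + int d - int n) \<omega> * x (s - int k) \<omega>))"
    unfolding partial_def sum_product
    by (intro Bochner_Integration.integral_cong sum.cong refl) simp
  also have "\<dots> = (\<Sum>n<m. \<Sum>k<m. (fps_nth g n * fps_nth g k) *
        expectation (\<lambda>\<omega>. x (s + int d - int n) \<omega> * x (s - int k) \<omega>))"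
    by (simp add: Bochner_Integration.integral_sum x_prod_integrable)
  \<comment> \<open>Whiteness keeps only equal times, \<open>n = k + d\<close>. The guard
    \<open>d \<le> n\<close> is needed because subtraction of naturals truncates.\<close>
  also have "\<dots> = (\<Sum>n<m. \<Sum>k<m. if k = n - d \<and> d \<le> n then fps_nth g n * fps_nth g k * var else 0)"
    unfolding x_cov by (intro sum.cong) auto
  also have "\<dots> = (\<Sum>n<m. var * (fps_nth g n * fps_nth (fps_X ^ d * g) n))"
    by (intro sum.cong) (auto simp: fps_X_power_mult_nth sum.delta)
  finally show ?thesis by (simp add: sum_distrib_left)
qed

text \<open>A product of two partial sums is bounded by the sum of their squares, hence by two
  envelopes, whatever \<open>m\<close> is.\<close>

lemma filt_prod:
  "integrable M (\<lambda>\<omega>. filt g x t \<omega> * filt g x s \<omega>)"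
  "(\<lambda>m. expectation (\<lambda>\<omega>. partial m t \<omega> * partial m s \<omega>))
    \<longlonglongrightarrow> expectation (\<lambda>\<omega>. filt g x t \<omega> * filt g x s \<omega>)"
proof -
  have bound: "AE \<omega> in M. norm (partial m t \<omega> * partial m s \<omega>) \<le> envelope t \<omega> + envelope s \<omega>" for m
    using AE_partial_square_le
  proof eventually_elim
    case (elim \<omega>)
    have "2 * (\<bar>partial m t \<omega>\<bar> * \<bar>partial m s \<omega>\<bar>) \<le> (partial m t \<omega>)\<^sup>2 + (partial m s \<omega>)\<^sup>2"
      using sum_squares_bound[of "\<bar>partial m t \<omega>\<bar>" "\<bar>partial m s \<omega>\<bar>"] by simp
    also have "\<dots> \<le> envelope t \<omega> + envelope s \<omega>" using elim by (intro add_mono) auto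
    finally show ?case
      using order_trans[OF zero_le_power2 elim[rule_format, of m t]]
        order_trans[OF zero_le_power2 elim[rule_format, of m s]]
      by (simp add: abs_mult)
  qed
  have lim: "AE \<omega> in M. (\<lambda>m. partial m t \<omega> * partial m s \<omega>) \<longlonglongrightarrow> filt g x t \<omega> * filt g x s \<omega>"
    using AE_partial_tendsto by eventually_elim (intro tendsto_mult, auto)
  have int: "integrable M (\<lambda>\<omega>. envelope t \<omega> + envelope s \<omega>)"
    by (intro Bochner_Integration.integrable_add envelope_integrable)
  show "integrable M (\<lambda>\<omega>. filt g x t \<omega> * filt g x s \<omega>)"
    by (rule integrable_dominated_convergence[OF _ _ int lim bound]) measurable
  show "(\<lambda>m. expectation (\<lambda>\<omega>. partial m t \<omega> * partial m s \<omega>))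
      \<longlonglongrightarrow> expectation (\<lambda>\<omega>. filt g x t \<omega> * filt g x s \<omega>)"
    by (rule integral_dominated_convergence[OF _ _ int lim bound]) measurable
qed

lemma filt_mean: "expectation (filt g x t) = 0"
proof -
  have "(\<lambda>m. expectation (partial m t)) \<longlonglongrightarrow> expectation (filt g x t)"
  proof (rule integral_dominated_convergence[where w = "\<lambda>\<omega>. 1 + envelope t \<omega>"])
    show "AE \<omega> in M. (\<lambda>m. partial m t \<omega>) \<longlonglongrightarrow> filt g x t \<omega>"
      using AE_partial_tendsto by eventually_elim auto
    show "AE \<omega> in M. norm (partial m t \<omega>) \<le> 1 + envelope t \<omega>" for m
      using AE_partial_square_le
    proof eventually_elim
      case (elim \<omega>)
      have "2 * \<bar>partial m t \<omega>\<bar> \<le> 1 + (partial m t \<omega>)\<^sup>2"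
        using sum_squares_bound[of "\<bar>partial m t \<omega>\<bar>" 1] by simp
      then show ?case using elim[rule_format, of m t] by simp
    qed
  qed (auto intro!: envelope_integrable)
  then show ?thesis by (simp add: partial_mean LIMSEQ_const_iff)
qed

lemma filt_cov:
  "expectation (\<lambda>\<omega>. filt g x (s + int d) \<omega> * filt g x s \<omega>) = var * pairing g (fps_X ^ d * g)"
proof (rule LIMSEQ_unique[OF filt_prod(2)])
  have "bibo (fps_X ^ d * g)"
    using bibo_mult[OF bibo_poly[of "monom 1 d"] bibo] by (simp add: fps_of_poly_monom)
  from summable_pairing[OF bibo this]
  show "(\<lambda>m. expectation (\<lambda>\<omega>. partial m (s + int d) \<omega> * partial m s \<omega>))
      \<longlonglongrightarrow> var * pairing g (fps_X ^ d * g)"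
    unfolding partial_cov pairing_def by (intro tendsto_mult tendsto_const summable_LIMSEQ)
qed

lemma gaussian_process_filt:
  assumes "gaussian_process M x"
  shows "gaussian_process M (filt g x)"
  unfolding gaussian_process_def
proof (intro allI impI)
  fix T :: "int set" and a :: "int \<Rightarrow> real"
  assume fin: "finite T"
  let ?X = "\<lambda>m \<omega>. \<Sum>t\<in>T. a t * partial m t \<omega>" and ?Z = "\<lambda>\<omega>. \<Sum>t\<in>T. a t * filt g x t \<omega>"
  have part_int: "integrable M (\<lambda>\<omega>. partial m t \<omega> * partial m s \<omega>)" for m t s
    unfolding partial_def sum_product
    by (auto intro!: Bochner_Integration.integrable_sum integrable_mult_right x_prod_integrable
        simp: mult.assoc mult.left_commute[of "x _ _"])
  \<comment> \<open>Reduces the second moment of a finite combination to covariances, whose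
    convergence is already known; this is the variance condition of
    \<open>gaussian_rv_limit\<close>.\<close>
  have square: "expectation (\<lambda>\<omega>. (\<Sum>t\<in>T. a t * y t \<omega>)\<^sup>2) =
      (\<Sum>t\<in>T. \<Sum>s\<in>T. a t * a s * expectation (\<lambda>\<omega>. y t \<omega> * y s \<omega>))"
    if "\<And>t s. integrable M (\<lambda>\<omega>. y t \<omega> * y s \<omega>)" for y
  proof -
    have "(\<Sum>t\<in>T. a t * y t \<omega>)\<^sup>2 = (\<Sum>t\<in>T. \<Sum>s\<in>T. a t * a s * (y t \<omega> * y s \<omega>))" for \<omega>
      by (simp add: power2_eq_square sum_product mult_ac)
    then show ?thesis using that by (simp add: Bochner_Integration.integral_sum)
  qed
  show "gaussian_rv M ?Z"
  proof (rule gaussian_rv_limit)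
    fix m :: nat
    define P where "P = T \<times> {..<m}"
    define \<tau> where "\<tau> = (\<lambda>(t, n). t - int n)"
    \<comment> \<open>The delay windows of different times in \<open>T\<close> overlap, whereas
      \<open>gaussian_process\<close> speaks of a sum over distinct times. \<open>c s\<close>
      collects all contributions of the sample at time \<open>s\<close>.\<close>
    define c where "c s = (\<Sum>(t, n)\<in>{p \<in> P. \<tau> p = s}. a t * fps_nth g n)" for s
    have "?X m \<omega> = (\<Sum>s\<in>\<tau> ` P. c s * x s \<omega>)" for \<omega>
    proof -
      have "?X m \<omega> = (\<Sum>(t, n)\<in>P. a t * fps_nth g n * x (\<tau> (t, n)) \<omega>)"
        by (simp add: partial_def P_def \<tau>_def sum.cartesian_product[symmetric] sum_distrib_left mult.assoc)
      also have "\<dots> = (\<Sum>s\<in>\<tau> ` P. \<Sum>(t, n)\<in>{p \<in> P. \<tau> p = s}. a t * fps_nth g n * x (\<tau> (t, n)) \<omega>)"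
        by (rule sum.image_gen) (simp add: P_def fin)
      also have "\<dots> = (\<Sum>s\<in>\<tau> ` P. c s * x s \<omega>)"
        unfolding c_def sum_distrib_right by (intro sum.cong) (auto simp: case_prod_beta)
      finally show ?thesis .
    qed
    moreover have "finite (\<tau> ` P)" by (simp add: P_def fin)
    ultimately show "gaussian_rv M (?X m)"
      using assms unfolding gaussian_process_def by presburger
    show "expectation (?X m) = 0"
      by (subst Bochner_Integration.integral_sum) (simp_all add: partial_mean partial_integrable)
  next
    show "AE \<omega> in M. (\<lambda>m. ?X m \<omega>) \<longlonglongrightarrow> ?Z \<omega>"
      using AE_partial_tendsto by eventually_elim (intro tendsto_intros, auto)
    show "?Z \<in> borel_measurable M" by measurable
    show "integrable M (\<lambda>\<omega>. (?Z \<omega>)\<^sup>2)"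
      unfolding power2_eq_square sum_product
      by (auto intro!: Bochner_Integration.integrable_sum integrable_mult_right filt_prod
          simp: mult.assoc mult.left_commute[of "filt _ _ _ _"])
    show "(\<lambda>m. expectation (\<lambda>\<omega>. (?X m \<omega>)\<^sup>2)) \<longlonglongrightarrow> expectation (\<lambda>\<omega>. (?Z \<omega>)\<^sup>2)"
      unfolding square[OF part_int] square[OF filt_prod(1)]
      by (intro tendsto_sum tendsto_mult tendsto_const filt_prod(2))
  qed
qed

lemma white_noise_filt:
  assumes "\<And>d. pairing g (fps_X ^ d * g) = (if d = 0 then c\<^sup>2 else 0)"
  shows "white_noise M (filt g x) (c\<^sup>2 * var)"
proof -
  \<comment> \<open>Lags are natural numbers in the pairing; negative ones follow by symmetry of the
    product.\<close>
  have cov: "expectation (\<lambda>\<omega>. filt g x t \<omega> * filt g x s \<omega>) = (if t = s then c\<^sup>2 * var else 0)"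
    if "s \<le> t" for t s
    using filt_cov[of s "nat (t - s)"] that by (auto simp: assms)
  have "expectation (\<lambda>\<omega>. filt g x t \<omega> * filt g x s \<omega>) = (if t = s then c\<^sup>2 * var else 0)" for t s
    using cov[of s t] cov[of t s] by (cases "s \<le> t") (auto simp: mult.commute)
  then show ?thesis
    using filt_prod(1) by (auto simp: white_noise_def second_order_def filt_mean power2_eq_square)
qed

end

section \<open>The predictor form\<close>

text \<open>Multiplying a row of \<open>G\<close> by its common denominator \<open>d\<close> makes it polynomial; a stable \<open>L\<close>
  applied to the resulting difference equation may cancel the stable part of \<open>d\<close>.\<close>

lemma AE_filt_node_equation:
  fixes G :: "((real fps)^'l^'l::finite)"
  assumes eq: "node_equation M G w r v j"
    and p: "\<And>l. fps_of_poly d * G $ j $ l = fps_of_poly (p l)"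
    and w: "\<And>k. mean_bounded M (w k)" and r: "mean_bounded M (r j)" and v: "mean_bounded M (v j)"
    and L: "bibo L"
  shows "AE \<omega> in M. \<forall>t. filt (L * fps_of_poly d) (w j) t \<omega> =
    (\<Sum>l\<in>in_neighbours G j. filt (L * fps_of_poly (p l)) (w l) t \<omega>) +
    filt (L * fps_of_poly d) (r j) t \<omega> + filt (L * fps_of_poly d) (v j) t \<omega>"
proof -
  let ?d = "fps_of_poly d" and ?p = "\<lambda>l. fps_of_poly (p l)" and ?N = "in_neighbours G j"
  let ?u = "\<lambda>t \<omega>. r j t \<omega> + v j t \<omega>"
  have Ld: "bibo (L * ?d)" by (intro bibo_mult L bibo_poly)
  have "\<forall>t. AE \<omega> in M. filt ?d (w j) t \<omega> = (\<Sum>l\<in>?N. filt (?p l) (w l) t \<omega>) + filt ?d ?u t \<omega>"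
    using eq p unfolding node_equation_def by blast
  \<comment> \<open>\<open>L\<close> reads the whole past of a path, so the equation must hold at
    all times outside a single null set.\<close>
  then have eqn: "AE \<omega> in M. \<forall>t. filt ?d (w j) t \<omega> =
      (\<Sum>l\<in>?N. filt (?p l) (w l) t \<omega>) + filt ?d ?u t \<omega>"
    unfolding AE_all_countable .
  have "AE \<omega> in M. \<forall>l\<in>?N. \<forall>t. filt_conv L (filt (?p l) (w l)) t \<omega> \<and>
      filt (L * ?p l) (w l) t \<omega> = filt L (filt (?p l) (w l)) t \<omega>"
    by (intro AE_finite_allI AE_filt_mult w L bibo_poly) simp
  with eqn AE_filt_mult[OF w[of j] L bibo_poly[of d]]
    AE_filt_mult[OF mean_bounded_add[OF r v] L bibo_poly[of d]]
    AE_filt_conv[OF r Ld] AE_filt_conv[OF v Ld]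
  show ?thesis
  proof eventually_elim
    case (elim \<omega>)
    show ?case
    proof
      fix t
      have "filt (L * ?d) (w j) t \<omega> = filt L (filt ?d (w j)) t \<omega>" using elim(2) by blast
      also have "\<dots> = filt L (\<lambda>t \<omega>. (\<Sum>l\<in>?N. filt (?p l) (w l) t \<omega>) + filt ?d ?u t \<omega>) t \<omega>"
        using elim(1) by (intro filt_cong) blast
      also have "\<dots> = filt L (\<lambda>t \<omega>. \<Sum>l\<in>?N. filt (?p l) (w l) t \<omega>) t \<omega> + filt L (filt ?d ?u) t \<omega>"
        using elim(3,6) by (intro filt_add filt_conv_sum) blast+
      also have "filt L (filt ?d ?u) t \<omega> = filt (L * ?d) ?u t \<omega>" using elim(3) by simp
      also have "\<dots> = filt (L * ?d) (r j) t \<omega> + filt (L * ?d) (v j) t \<omega>"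
        using elim(4,5) by (intro filt_add) blast+
      also have "filt L (\<lambda>t \<omega>. \<Sum>l\<in>?N. filt (?p l) (w l) t \<omega>) t \<omega> =
          (\<Sum>l\<in>?N. filt L (filt (?p l) (w l)) t \<omega>)"
        using elim(6) by (intro filt_sum) blast
      also have "\<dots> = (\<Sum>l\<in>?N. filt (L * ?p l) (w l) t \<omega>)"
        using elim(6) by (intro sum.cong) auto
      finally show "filt (L * ?d) (w j) t \<omega> = (\<Sum>l\<in>?N. filt (L * ?p l) (w l) t \<omega>) +
          filt (L * ?d) (r j) t \<omega> + filt (L * ?d) (v j) t \<omega>"
        by simp
    qed
  qed
qed

theorem proposition1:
  fixes M :: "'a measure"
    and B F :: "'l::finite \<Rightarrow> 'l \<Rightarrow> real poly"
    and G :: "(real fps)^'l^'l"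
    and w r v :: "'l \<Rightarrow> int \<Rightarrow> 'a \<Rightarrow> real"
    and e :: "int \<Rightarrow> 'a \<Rightarrow> real"
    and H Mj :: "real fps"
    and Mjk :: "'l \<Rightarrow> real fps"
    and Fs Fa :: "'l \<Rightarrow> real poly"
    and F_a F_a_star Fbar :: "real poly"
    and \<sigma> :: real
    and N :: "'l set"
    and i j :: 'l
  assumes "prob_space M"
    and modules: "\<And>k l. G $ k $ l = fps_of_poly (B k l) / fps_of_poly (F k l)"
      "\<And>k l. coeff (B k l) 0 = 0"
      "\<And>k l. monic_in_delay (F k l)"
    and zero_diagonal: "\<And>k. G $ k $ k = 0"
    and network: "\<And>k l. stable_tf (matrix_inv (mat 1 - G) $ k $ l)"
      "well_posed G"
    and process_noise: "\<And>k. stationary M (v k)"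
      "\<And>k. k \<noteq> j \<Longrightarrow> uncorrelated M (v j) (v k)"
    and excitation: "\<And>k. mean_bounded M (r k)"
    and node_signals: "\<And>k. mean_bounded M (w k)"
      "\<And>k. node_equation M G w r v k"
    and noise_model: "monic_tf H" "stable_tf H" "minimum_phase H"
      "gaussian_white_noise M e (\<sigma>\<^sup>2)"
      "\<And>t. AE \<omega> in M. v j t \<omega> = filt H e t \<omega>"
    and N: "N = in_neighbours G j" "i \<in> N"
    and factors: "\<And>k. k \<in> N \<Longrightarrow> F j k = Fs k * Fa k"
      "\<And>k. k \<in> N \<Longrightarrow> monic_in_delay (Fs k) \<and> stable_roots (Fs k)"
      "\<And>k. k \<in> N \<Longrightarrow> monic_in_delay (Fa k) \<and> antistable_roots (Fa k)"
    and F_a: "F_a = (\<Prod>k\<in>N. Fa k)"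
    and F_a_star: "F_a_star = (\<Prod>k\<in>N. mirror_poly (Fa k))"
    and Fbar: "Fbar = - (1 - F j i)"
    and Mj: "Mj = 1 - inverse H *
      (fps_of_poly (\<Prod>k\<in>N - {i}. Fa k) / fps_of_poly (F_a_star * Fs i))"
    and Mjk: "\<And>k. k \<in> N - {i} \<Longrightarrow> Mjk k = inverse H *
      (fps_of_poly (\<Prod>l\<in>N - {k}. Fa l) / fps_of_poly F_a_star) *
      (fps_of_poly (B j k) / fps_of_poly (Fs k))"
  shows "strictly_proper Mj \<and> stable_tf Mj \<and>
    (\<forall>k\<in>N - {i}. strictly_proper (Mjk k) \<and> stable_tf (Mjk k)) \<and>
    stable_tf (fps_of_poly (B j i)) \<and> stable_tf (fps_of_poly Fbar) \<and>
    G $ j $ i = fps_of_poly (B j i) / fps_of_poly (F j i) \<and>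
    G $ j $ i = fps_of_poly (B j i) / (1 + fps_of_poly Fbar) \<and>
    (\<exists>ebar. gaussian_white_noise M ebar (\<bar>lead_coeff F_a\<bar>\<^sup>2 * \<sigma>\<^sup>2) \<and>
      ((\<forall>t. AE \<omega> in M. r j t \<omega> = 0) \<longrightarrow>
        (\<forall>t. AE \<omega> in M. w j t \<omega> =
          filt Mj (w j) t \<omega>
          - filt ((1 - Mj) * fps_of_poly Fbar) (w j) t \<omega>
          + filt ((1 - Mj) * fps_of_poly (B j i)) (w i) t \<omega>
          + (\<Sum>k\<in>N - {i}. filt (Mjk k) (w k) t \<omega>)
          + ebar t \<omega>)) \<and>
      (\<forall>t. AE \<omega> in M. w j t \<omega> =
          filt Mj (w j) t \<omega>
          - filt ((1 - Mj) * fps_of_poly Fbar) (w j) t \<omega>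
          + filt ((1 - Mj) * fps_of_poly (B j i)) (w i) t \<omega>
          + (\<Sum>k\<in>N - {i}. filt (Mjk k) (w k) t \<omega>)
          + filt ((1 - Mj) * (1 + fps_of_poly Fbar)) (r j) t \<omega>
          + ebar t \<omega>))"
proof -
  interpret prob_space M by fact
  define Hi where "Hi = inverse H"
  define D where "D = inverse (fps_of_poly F_a_star)"
  define U where "U = (\<lambda>k. inverse (fps_of_poly (Fs k)))"
  \<comment> \<open>The common shape of the predictor filters: \<open>1 - Mj\<close> is
    \<open>W i\<close>, and \<open>Mjk k\<close> is \<open>W k\<close> times
    \<open>B j k\<close>.\<close>
  define W where "W = (\<lambda>k. Hi * fps_of_poly (\<Prod>l\<in>N - {k}. Fa l) * D * U k)"
  define K where "K = Hi * (fps_of_poly F_a * D)"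
  \<comment> \<open>Chosen so that \<open>L * d = K\<close>: the factors \<open>U k\<close> cancel
    the stable parts of \<open>d\<close>, leaving the anti-stable product \<open>F_a\<close>, which
    stays in the numerator.\<close>
  define L where "L = Hi * (D * (\<Prod>k\<in>N. U k))"
  define d where "d = (\<Prod>k\<in>N. F j k)"
  define p where "p = (\<lambda>l. if l \<in> N then (\<Prod>k\<in>N - {l}. F j k) * B j l else 0)"

  have H0: "fps_nth H 0 = 1" using noise_model(1) by (simp add: monic_tf_def)
  have Hi_H: "Hi * H = 1" by (simp add: Hi_def H0 inverse_mult_eq_1)
  have Hi_stable: "stable_tf Hi" unfolding Hi_def by (rule stable_tf_inverse[OF noise_model(3)])
  have Hi0: "fps_nth Hi 0 = 1" by (simp add: Hi_def H0)
  have F_a_star': "F_a_star = mirror_poly F_a" by (simp add: F_a_star F_a mirror_poly_prod)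
  have F_a0: "coeff F_a 0 = 1"
    using monic_in_delay_prod[of N Fa] factors(3) by (simp add: F_a monic_in_delay_def)
  have star: "monic_in_delay F_a_star" "stable_roots F_a_star"
    unfolding F_a_star using factors(3)
    by (auto intro!: monic_in_delay_prod stable_roots_prod monic_in_delay_mirror_poly
        stable_roots_mirror_poly)
  have star0: "coeff F_a_star 0 = 1" using star(1) by (simp add: monic_in_delay_def)
  have D_stable: "stable_tf D"
    using stable_tf_divide[of F_a_star 1] star0 star(2) by (simp add: D_def fps_divide_unit)
  have D0: "fps_nth D 0 = 1" by (simp add: D_def star0)
  have Fs0: "coeff (Fs k) 0 = 1" if "k \<in> N" for k
    using factors(2)[OF that] by (simp add: monic_in_delay_def)
  have U: "U k * fps_of_poly (Fs k) = 1" if "k \<in> N" for k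
    by (simp add: U_def inverse_mult_eq_1 Fs0[OF that])
  have U_stable: "stable_tf (U k)" if "k \<in> N" for k
    using stable_tf_divide[of "Fs k" 1] factors(2)[OF that] Fs0[OF that]
    by (simp add: U_def fps_divide_unit)
  have U0: "fps_nth (U k) 0 = 1" if "k \<in> N" for k by (simp add: U_def Fs0[OF that])
  have P0: "coeff (\<Prod>l\<in>N - {k}. Fa l) 0 = 1" for k
    using monic_in_delay_prod[of "N - {k}" Fa] factors(3) by (simp add: monic_in_delay_def)
  have W_stable: "stable_tf (W k)" if "k \<in> N" for k
    unfolding W_def by (intro stable_tf_mult Hi_stable D_stable U_stable that stable_tf_poly)
  have W0: "fps_nth (W k) 0 = 1" if "k \<in> N" for k
    unfolding W_def using P0 by (simp add: Hi0 D0 U0[OF that])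
  have Mj_W: "1 - Mj = W i"
    unfolding Mj W_def D_def U_def Hi_def using star0 Fs0[OF N(2)]
    by (simp add: fps_divide_unit fps_of_poly_mult fps_inverse_mult mult_ac)
  then have Mj': "Mj = 1 - W i" by (simp add: algebra_simps)
  have Mjk_W: "Mjk k = W k * fps_of_poly (B j k)" if "k \<in> N - {i}" for k
    unfolding Mjk[OF that] W_def D_def U_def Hi_def using star0 Fs0 that
    by (simp add: fps_divide_unit mult_ac)
  have L_stable: "stable_tf L"
  proof -
    have "stable_tf (\<Prod>k\<in>A. U k)" if "A \<subseteq> N" for A
      using that by (induction A rule: infinite_finite_induct)
        (auto intro: stable_tf_1 stable_tf_mult U_stable)
    then show ?thesis unfolding L_def by (intro stable_tf_mult Hi_stable D_stable) simp
  qed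
  have K_stable: "stable_tf K"
    unfolding K_def by (intro stable_tf_mult Hi_stable D_stable stable_tf_poly)

  have F_prod: "fps_of_poly (\<Prod>k\<in>A. F j k) * (\<Prod>k\<in>A. U k) = fps_of_poly (\<Prod>k\<in>A. Fa k)"
    if "A \<subseteq> N" for A
  proof -
    have "fps_of_poly (F j k) * U k = fps_of_poly (Fa k)" if "k \<in> N" for k
      using U[OF that] by (simp add: factors(1)[OF that] fps_of_poly_mult mult_ac)
    then show ?thesis
      using that by (simp add: fps_of_poly_prod prod.distrib[symmetric] subset_eq)
  qed
  have Ld: "L * fps_of_poly d = K"
    using F_prod[of N] by (simp add: L_def K_def d_def F_a mult_ac)
  have Lp: "L * fps_of_poly (p l) = W l * fps_of_poly (B j l)" if "l \<in> N" for l
    using F_prod[of "N - {l}"] that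
    by (simp add: L_def p_def W_def fps_of_poly_mult prod.remove[of N l U] mult_ac)
  \<comment> \<open>\<open>U i\<close> cancels the stable factor of \<open>F j i\<close>, and its
    anti-stable factor \<open>Fa i\<close> completes the product to \<open>F_a\<close>.\<close>
  have WF: "W i * (1 + fps_of_poly Fbar) = K"
  proof -
    have F: "1 + fps_of_poly Fbar = fps_of_poly (F j i)"
      by (simp add: Fbar fps_of_poly_diff fps_of_poly_uminus)
    have "fps_of_poly (F j i) * U i = fps_of_poly (Fa i)"
      using F_prod[of "{i}"] N(2) by simp
    then show ?thesis
      unfolding F using prod.remove[of N i Fa] N(2)
      by (simp add: W_def K_def F_a fps_of_poly_mult mult_ac)
  qed
  have dG: "fps_of_poly d * G $ j $ l = fps_of_poly (p l)" for l
  proof (cases "l \<in> N")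
    case True
    have "fps_of_poly (F j l) * (fps_of_poly (B j l) / fps_of_poly (F j l)) = fps_of_poly (B j l)"
      using modules(3)[of j l] inverse_mult_eq_1'[of "fps_of_poly (F j l)"]
      by (simp add: monic_in_delay_def fps_divide_unit mult.left_commute[of _ "fps_of_poly (B j l)"])
    then show ?thesis
      using True prod.remove[of N l "F j"]
      by (simp add: d_def p_def modules(1) fps_of_poly_mult mult_ac)
  next
    case False
    then show ?thesis by (simp add: p_def N(1) in_neighbours_def)
  qed

  define g where "g = fps_of_poly F_a / fps_of_poly F_a_star"
  have g: "g = fps_of_poly F_a * D" using star0 by (simp add: g_def D_def fps_divide_unit)
  have g_stable: "stable_tf g" unfolding g by (intro stable_tf_mult stable_tf_poly D_stable)
  \<comment> \<open>The noise model cancels, so the transformed noise is the all-pass filter applied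
    directly to \<open>e\<close>.\<close>
  have KH: "K * H = g" using Hi_H by (simp add: K_def g mult_ac)
  define ebar where "ebar = filt g e"
  have e_white: "white_noise M e (\<sigma>\<^sup>2)" using noise_model(4) by (simp add: gaussian_white_noise_def)
  interpret e: filtered_white_noise M e "\<sigma>\<^sup>2" g
    by unfold_locales (use e_white bibo_stable_tf[OF g_stable] in auto)
  have ebar_white: "gaussian_white_noise M ebar (\<bar>lead_coeff F_a\<bar>\<^sup>2 * \<sigma>\<^sup>2)"
    unfolding gaussian_white_noise_def ebar_def
  proof (intro conjI e.gaussian_process_filt e.white_noise_filt)
    show "gaussian_process M e" using noise_model(4) by (simp add: gaussian_white_noise_def)
    show "pairing g (fps_X ^ k * g) = (if k = 0 then \<bar>lead_coeff F_a\<bar>\<^sup>2 else 0)" for k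
      using pairing_all_pass[of F_a g k] F_a0 bibo_stable_tf[OF D_stable]
      by (simp add: g_def D_def F_a_star')
  qed

  have vj: "mean_bounded M (v j)" by (rule mean_bounded_stationary[OF process_noise(1)])
  have v_e: "AE \<omega> in M. \<forall>t. v j t \<omega> = filt H e t \<omega>"
    unfolding AE_all_countable using noise_model(5) by blast
  have "AE \<omega> in M. \<forall>t. w j t \<omega> =
      filt Mj (w j) t \<omega>
      - filt ((1 - Mj) * fps_of_poly Fbar) (w j) t \<omega>
      + filt ((1 - Mj) * fps_of_poly (B j i)) (w i) t \<omega>
      + (\<Sum>k\<in>N - {i}. filt (Mjk k) (w k) t \<omega>)
      + filt ((1 - Mj) * (1 + fps_of_poly Fbar)) (r j) t \<omega>
      + ebar t \<omega>"
    using AE_filt_node_equation[OF node_signals(2)[of j] dG node_signals(1) excitation vj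
        bibo_stable_tf[OF L_stable]] v_e
      AE_filt_mult[OF mean_bounded_white_noise[OF e_white] bibo_stable_tf[OF K_stable]
        bibo_stable_tf[OF noise_model(2)]]
      AE_filt_conv[OF node_signals(1)[of j] bibo_stable_tf[OF K_stable]]
      AE_filt_conv[OF node_signals(1)[of j] bibo_stable_tf[OF stable_tf_diff[OF stable_tf_1 W_stable[OF N(2)]]]]
      AE_filt_conv[OF node_signals(1)[of j] bibo_stable_tf[OF stable_tf_mult[OF W_stable[OF N(2)] stable_tf_poly[of Fbar]]]]
      AE_filt_conv[OF node_signals(1)[of j] bibo_stable_tf[OF W_stable[OF N(2)]]]
  proof eventually_elim
    case (elim \<omega>)
    show ?case
    proof
      fix t
      \<comment> \<open>\<open>w j\<close> is split by \<open>Mj\<close> and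
        \<open>1 - Mj = W i\<close>. The second part is \<open>K\<close> minus
        \<open>W i * Fbar\<close> acting on \<open>w j\<close>, and \<open>K\<close> acting on
        \<open>w j\<close> is given by the filtered node equation.\<close>
      have "w j t \<omega> = filt ((1 - W i) + W i) (w j) t \<omega>" by (simp add: filt_1)
      also have "\<dots> = filt Mj (w j) t \<omega> + filt (W i) (w j) t \<omega>"
        unfolding Mj' using elim(5,7) by (intro filt_add_left) blast+
      finally have 1: "w j t \<omega> = filt Mj (w j) t \<omega> + filt (W i) (w j) t \<omega>" .
      have "K = W i + W i * fps_of_poly Fbar" using WF by (simp add: distrib_left)
      then have "filt K (w j) t \<omega> = filt (W i) (w j) t \<omega> + filt (W i * fps_of_poly Fbar) (w j) t \<omega>"
        using elim(6,7) by (simp only:) (intro filt_add_left, blast+)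
      moreover have "filt K (w j) t \<omega> = (\<Sum>l\<in>N. filt (W l * fps_of_poly (B j l)) (w l) t \<omega>)
          + filt K (r j) t \<omega> + filt K (v j) t \<omega>"
        using elim(1) by (simp add: Ld Lp N(1)[symmetric])
      moreover have "(\<Sum>l\<in>N. filt (W l * fps_of_poly (B j l)) (w l) t \<omega>) =
          filt (W i * fps_of_poly (B j i)) (w i) t \<omega> + (\<Sum>k\<in>N - {i}. filt (Mjk k) (w k) t \<omega>)"
        using N(2) by (simp add: sum.remove[of N i] Mjk_W)
      moreover have "filt K (v j) t \<omega> = filt K (filt H e) t \<omega>"
        using elim(2) by (intro filt_cong) blast
      moreover have "filt K (filt H e) t \<omega> = ebar t \<omega>"
        using elim(3) by (simp add: KH ebar_def)
      ultimately show "w j t \<omega> =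
          filt Mj (w j) t \<omega>
          - filt ((1 - Mj) * fps_of_poly Fbar) (w j) t \<omega>
          + filt ((1 - Mj) * fps_of_poly (B j i)) (w i) t \<omega>
          + (\<Sum>k\<in>N - {i}. filt (Mjk k) (w k) t \<omega>)
          + filt ((1 - Mj) * (1 + fps_of_poly Fbar)) (r j) t \<omega>
          + ebar t \<omega>"
        using 1 unfolding Mj_W WF by linarith
    qed
  qed
  then have excited: "\<forall>t. AE \<omega> in M. w j t \<omega> =
      filt Mj (w j) t \<omega>
      - filt ((1 - Mj) * fps_of_poly Fbar) (w j) t \<omega>
      + filt ((1 - Mj) * fps_of_poly (B j i)) (w i) t \<omega>
      + (\<Sum>k\<in>N - {i}. filt (Mjk k) (w k) t \<omega>)
      + filt ((1 - Mj) * (1 + fps_of_poly Fbar)) (r j) t \<omega>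
      + ebar t \<omega>"
    unfolding AE_all_countable .
  have unexcited: "\<forall>t. AE \<omega> in M. w j t \<omega> =
      filt Mj (w j) t \<omega>
      - filt ((1 - Mj) * fps_of_poly Fbar) (w j) t \<omega>
      + filt ((1 - Mj) * fps_of_poly (B j i)) (w i) t \<omega>
      + (\<Sum>k\<in>N - {i}. filt (Mjk k) (w k) t \<omega>)
      + ebar t \<omega>" if r0: "\<forall>t. AE \<omega> in M. r j t \<omega> = 0"
  proof
    fix t
    \<comment> \<open>The filter consults all past values of \<open>r j\<close>, so they must vanish
      simultaneously.\<close>
    have "AE \<omega> in M. \<forall>t. r j t \<omega> = 0" using r0 unfolding AE_all_countable .
    then show "AE \<omega> in M. w j t \<omega> =
        filt Mj (w j) t \<omega>
        - filt ((1 - Mj) * fps_of_poly Fbar) (w j) t \<omega>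
        + filt ((1 - Mj) * fps_of_poly (B j i)) (w i) t \<omega>
        + (\<Sum>k\<in>N - {i}. filt (Mjk k) (w k) t \<omega>)
        + ebar t \<omega>"
      using excited[rule_format, of t]
      by eventually_elim (simp add: filt_def[of "_ * (1 + _)"])
  qed

  \<comment> \<open>\<open>W i\<close> has constant coefficient 1, so \<open>1 - W i\<close> has no
    direct term; in \<open>Mjk k\<close> the direct term is removed by \<open>B j k\<close>.\<close>
  have "strictly_proper Mj" "stable_tf Mj"
    using W0[OF N(2)] stable_tf_diff[OF stable_tf_1 W_stable[OF N(2)]]
    by (simp_all add: Mj' strictly_proper_def)
  moreover have "\<forall>k\<in>N - {i}. strictly_proper (Mjk k) \<and> stable_tf (Mjk k)"
    using modules(2) W_stable by (auto simp: Mjk_W strictly_proper_def intro!: stable_tf_mult stable_tf_poly)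
  moreover have "G $ j $ i = fps_of_poly (B j i) / (1 + fps_of_poly Fbar)"
    by (simp add: modules(1) Fbar fps_of_poly_diff fps_of_poly_uminus)
  ultimately show ?thesis
    using ebar_white excited unexcited modules(1) stable_tf_poly by blast
qed

end
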